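(* (i) The internal tangent map of a diffeological étale map at each point is an isomorphism. (ii) On a manifold, étale spaces and diffeological étale spaces are the same: a map $\pi:\mathcal{E}\to M$ from a diffeological space into a manifold $M$ is étale if and only if it is a diffeological étale map. (iii) For a diffeological étale map $\pi:\mathcal{E}\to X$, the stalks $\pi^{-1}(x)$, $x\in X$, are all discrete subspaces of $\mathcal{E}$. (iv) Any diffeological étale map is a D-open map (it maps D-open subsets to D-open subsets). (v) Any injective diffeological étale map is a diffeological embedding.
   Context: An $n$-domain is an open subset of $\mathbb{R}^n$; a domain is an $n$-domain for some $n\ge 0$. A parametrization in a set $X$ is a map from a domain to $X$. A diffeology on $X$ is a set $\mathcal{D}$ of parametrizations in $X$ such that: (D1) the images of the elements of $\mathcal{D}$ cover $X$; (D2) $P\circ F\in\mathcal{D}$ for every $P:U\to X$ in $\mathcal{D}$ and every smooth map $F:V\to U$ between domains; (D3) if a family of $n$-parametrizations $P_i:U_i\to X$ in $\mathcal{D}$ agree on overlaps, their common extension to $\bigcup_i U_i$ is in $\mathcal{D}$. A diffeological space is a set with a diffeology, whose elements are called plots. A map $f:X\to Y$ is smooth if $f\circ P$ is a plot in $Y$ for every plot $P$ in $X$; a diffeomorphism is a smooth bijection with smooth inverse. A subset of $X$ is D-open if its preimage under every plot is open; this defines the D-topology. Subsets carry the subspace diffeology (plots with values in the subset), and the plots of a product are the tuples of plots. A space is discrete if its plots are exactly the locally constant parametrizations. Domains and manifolds carry their usual smooth parametrizations as plots. For smooth maps $f:X\to Y$ and $g:Z\to Y$, the pullback of $f$ by $g$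 is $g^*f:g^*X\to Z$, $(z,x)\mapsto z$, where $g^*X=\{(z,x)\in Z\times X: g(z)=f(x)\}$. Internal tangent space: for $x\in X$, consider the category whose objects are the plots $P:U\to X$ with $0\in U$ and $P(0)=x$ (plots centered at $x$), and whose morphisms from $Q:V\to X$ to $P:U\to X$ are the germs at $0$ of smooth maps $F:W\to U$, $W\subseteq V$ an open neighborhood of $0$, with $F(0)=0$ and $Q|_W=P\circ F$. The internal tangent space $T_xX$ is the colimit in real vector spaces of the functor sending $P:U\to X$ to $T_0U$ and the germ of $F$ to $dF_0$; write $dP_0:T_0U\to T_xX$ for the structure maps. For smooth $f:X\to Y$, the internal tangent map $df_x:T_xX\to T_{f(x)}Y$ is the unique linear map with $df_x\circ dP_0=d(f\circ P)_0$ for every plot $P$ centered at $x$. Étale map: a map $f:X\to Y$ such that every $x_0\in X$ has a D-open neighborhood $O\subseteq X$, and $f(x_0)$ a D-open neighborhood $O'\subseteq Y$, with $f|_O:O\to O'$ a diffeomorphism. Diffeological étale map: a smooth map whose pullback by every plot in the target is étale. An étale space (resp. diffeological étale space) on $X$ is the source of an étale (resp. diffeological étale) map into $X$. Diffeological immersion: a smooth map $f:X\to Y$ such that for every plot $P:U\to Y$ and every $(r_0,x_0)\in P^*X$ there exist a D-open neighborhood $O$ of $(r_0,x_0)$ in $P^*X$, an open neighborhood $V\subseteq U$ of $P^*f(O)$ and a smooth map $\varrho:V\to U\times X$ such that $\varrho\circ P^*f(r,x)=(r,x)$ for all $(r,x)\in O$. Diffeological embedding: a diffeological immersion that is a topological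 embedding with respect to the D-topologies. *)

theory Defs
  imports "HOL-Analysis.Analysis" "HOL-Analysis.Finite_Function_Topology"
begin

section \<open>Smooth maps between domains\<close>

text \<open>
  The dimension of a domain varies inside the definition of a diffeology, so points of
  $R^n$ are the sequences vanishing from index \<open>n\<close> on, with the library topology
  \<^const>\<open>Euclidean_space\<close>. This topology is induced by the product topology of the
  type \<open>nat \<Rightarrow> real\<close>, so \<^const>\<open>continuous_on\<close> below has its usual meaning.
\<close>

type_synonym rvec = "nat \<Rightarrow> real"

text \<open>\<open>Ck n k U g\<close>: the partial derivatives of \<open>g\<close> in the first \<open>n\<close> coordinates, up to
  order \<open>k\<close>, exist and are continuous on the open subset \<open>U\<close> of $R^n$.\<close>

primrec Ck :: "nat \<Rightarrow> nat \<Rightarrow> rvec set \<Rightarrow> (rvec \<Rightarrow> real) \<Rightarrow> bool" where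
  "Ck n 0 U g \<longleftrightarrow> continuous_on U g"
| "Ck n (Suc k) U g \<longleftrightarrow> continuous_on U g \<and>
     (\<forall>i<n. \<exists>h. (\<forall>x\<in>U. ((\<lambda>t. g (x(i := t))) has_real_derivative h x) (at (x i))) \<and> Ck n k U h)"

definition smooth_map :: "nat \<Rightarrow> rvec set \<Rightarrow> nat \<Rightarrow> rvec set \<Rightarrow> (rvec \<Rightarrow> rvec) \<Rightarrow> bool" where
  "smooth_map n U m V F \<longleftrightarrow> F \<in> U \<rightarrow> V \<and> (\<forall>j<m. \<forall>k. Ck n k U (\<lambda>x. F x j))"

text \<open>\<open>jacobian n F x u\<close> is $dF_x(u)$, for \<open>F\<close> defined near \<open>x\<close> in $R^n$.\<close>

definition jacobian :: "nat \<Rightarrow> (rvec \<Rightarrow> rvec) \<Rightarrow> rvec \<Rightarrow> rvec \<Rightarrow> rvec" where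
  "jacobian n F x u = (\<lambda>j. \<Sum>i<n. deriv (\<lambda>t. F (x(i := t)) j) (x i) * u i)"


section \<open>Diffeological spaces\<close>

text \<open>A parametrization \<open>P\<close> defined on a domain \<open>U\<close> of $R^n$ is the triple \<open>(n, U, P)\<close>.
  Outside \<open>U\<close> the function \<open>P\<close> takes the value \<^const>\<open>undefined\<close>, so that equal
  parametrizations are equal triples.\<close>

type_synonym 'a param = "nat \<times> rvec set \<times> (rvec \<Rightarrow> 'a)"

definition parametrizations :: "'a set \<Rightarrow> 'a param set" where
  "parametrizations A = {(n, U, P). openin (Euclidean_space n) U \<and> P \<in> U \<rightarrow>\<^sub>E A}"

record 'a diffspace =
  points :: "'a set"
  plots :: "'a param set"

definition diffeological_space :: "'a diffspace \<Rightarrow> bool" where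
  "diffeological_space X \<longleftrightarrow>
     plots X \<subseteq> parametrizations (points X) \<and>
     (\<Union>(n, U, P)\<in>plots X. P ` U) = points X \<and>
     (\<forall>(n, U, P)\<in>plots X. \<forall>m V F.
        openin (Euclidean_space m) V \<and> smooth_map m V n U F
          \<longrightarrow> (m, V, restrict (P \<circ> F) V) \<in> plots X) \<and>
     (\<forall>n S P. (\<forall>(U, Q)\<in>S. (n, U, Q) \<in> plots X) \<and>
        (\<forall>(U, Q)\<in>S. \<forall>(V, R)\<in>S. \<forall>r\<in>U \<inter> V. Q r = R r) \<and>
        P \<in> extensional (\<Union>(U, Q)\<in>S. U) \<and> (\<forall>(U, Q)\<in>S. \<forall>r\<in>U. P r = Q r)
          \<longrightarrow> (n, (\<Union>(U, Q)\<in>S. U), P) \<in> plots X)"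

definition smooth :: "'a diffspace \<Rightarrow> 'b diffspace \<Rightarrow> ('a \<Rightarrow> 'b) \<Rightarrow> bool" where
  "smooth X Y f \<longleftrightarrow> f \<in> points X \<rightarrow> points Y \<and>
     (\<forall>(n, U, P)\<in>plots X. (n, U, restrict (f \<circ> P) U) \<in> plots Y)"

definition diffeomorphism :: "'a diffspace \<Rightarrow> 'b diffspace \<Rightarrow> ('a \<Rightarrow> 'b) \<Rightarrow> bool" where
  "diffeomorphism X Y f \<longleftrightarrow>
     bij_betw f (points X) (points Y) \<and> smooth X Y f \<and> smooth Y X (inv_into (points X) f)"

definition D_open :: "'a diffspace \<Rightarrow> 'a set \<Rightarrow> bool" where
  "D_open X A \<longleftrightarrow> A \<subseteq> points X \<and>
     (\<forall>(n, U, P)\<in>plots X. openin (Euclidean_space n) {r \<in> U. P r \<in> A})"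

definition D_topology :: "'a diffspace \<Rightarrow> 'a topology" where
  "D_topology X = topology (D_open X)"

lemma istopology_D_open: "istopology (D_open X)"
  unfolding istopology_def
proof (intro conjI allI impI)
  fix A B assume A: "D_open X A" and B: "D_open X B"
  have "{r \<in> U. P r \<in> A \<inter> B} = {r \<in> U. P r \<in> A} \<inter> {r \<in> U. P r \<in> B}" for U and P :: "rvec \<Rightarrow> 'a"
    by auto
  with A B show "D_open X (A \<inter> B)"
    by (fastforce simp: D_open_def)
next
  fix K assume K: "\<forall>A\<in>K. D_open X A"
  have "{r \<in> U. P r \<in> \<Union>K} = \<Union>((\<lambda>A. {r \<in> U. P r \<in> A}) ` K)" for U and P :: "rvec \<Rightarrow> 'a"
    by auto
  with K show "D_open X (\<Union>K)"
    by (fastforce simp: D_open_def intro: openin_Union)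
qed

lemma openin_D_topology: "openin (D_topology X) = D_open X"
  by (simp add: D_topology_def istopology_D_open topology_inverse')

definition subspace_diff :: "'a diffspace \<Rightarrow> 'a set \<Rightarrow> 'a diffspace" where
  "subspace_diff X A =
     \<lparr>points = points X \<inter> A, plots = {(n, U, P) \<in> plots X. P ` U \<subseteq> A}\<rparr>"

definition prod_diff :: "'a diffspace \<Rightarrow> 'b diffspace \<Rightarrow> ('a \<times> 'b) diffspace" where
  "prod_diff X Y =
     \<lparr>points = points X \<times> points Y,
      plots = {(n, U, P) \<in> parametrizations (points X \<times> points Y).
        (n, U, restrict (fst \<circ> P) U) \<in> plots X \<and> (n, U, restrict (snd \<circ> P) U) \<in> plots Y}\<rparr>"

definition domain_diff :: "nat \<Rightarrow> rvec set \<Rightarrow> rvec diffspace" where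
  "domain_diff n U =
     \<lparr>points = U, plots = {(m, V, F) \<in> parametrizations U. smooth_map m V n U F}\<rparr>"

definition discrete_diff :: "'a diffspace \<Rightarrow> bool" where
  "discrete_diff X \<longleftrightarrow>
     plots X = {(n, U, P) \<in> parametrizations (points X).
       \<forall>r\<in>U. \<exists>V. openin (Euclidean_space n) V \<and> r \<in> V \<and> V \<subseteq> U \<and> (\<forall>s\<in>V. P s = P r)}"

text \<open>The source $g^*X$ of the pullback of \<open>f : X \<rightarrow> Y\<close> by \<open>g : Z \<rightarrow> Y\<close>; the pullback
  $g^*f$ itself is \<^const>\<open>fst\<close>.\<close>

definition pullback :: "'z diffspace \<Rightarrow> ('z \<Rightarrow> 'y) \<Rightarrow> 'x diffspace \<Rightarrow> ('x \<Rightarrow> 'y) \<Rightarrow> ('z \<times> 'x) diffspace"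
  where "pullback Z g X f =
     subspace_diff (prod_diff Z X) {(z, x). z \<in> points Z \<and> x \<in> points X \<and> g z = f x}"


section \<open>Manifolds\<close>

text \<open>A chart is a triple \<open>(n, D, \<phi>)\<close> with \<open>\<phi>\<close> a bijection from \<open>D\<close> onto an open subset
  of $R^n$. The topology of a manifold is the one for which its charts are homeomorphisms
  with open domains. No Hausdorff or countability condition is imposed on it, and the
  dimension may vary from one component to another, so this covers all the usual
  conventions.\<close>

type_synonym 'a chart = "nat \<times> 'a set \<times> ('a \<Rightarrow> rvec)"

definition smooth_atlas :: "'a set \<Rightarrow> 'a chart set \<Rightarrow> bool" where
  "smooth_atlas M \<A> \<longleftrightarrow>
     (\<Union>(n, D, \<phi>)\<in>\<A>. D) = M \<and>
     (\<forall>(n, D, \<phi>)\<in>\<A>. inj_on \<phi> D \<and> openin (Euclidean_space n) (\<phi> ` D)) \<and>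
     (\<forall>(n, D, \<phi>)\<in>\<A>. \<forall>(m, D', \<psi>)\<in>\<A>.
        openin (Euclidean_space n) (\<phi> ` (D \<inter> D')) \<and>
        smooth_map n (\<phi> ` (D \<inter> D')) m (\<psi> ` (D \<inter> D')) (\<psi> \<circ> inv_into D \<phi>))"

definition manifold_diff :: "'a set \<Rightarrow> 'a chart set \<Rightarrow> 'a diffspace" where
  "manifold_diff M \<A> =
     \<lparr>points = M,
      plots = {(m, U, P) \<in> parametrizations M. \<forall>(n, D, \<phi>)\<in>\<A>.
        openin (Euclidean_space m) {r \<in> U. P r \<in> D} \<and>
        smooth_map m {r \<in> U. P r \<in> D} n (\<phi> ` D) (\<phi> \<circ> P)}\<rparr>"


section \<open>Internal tangent spaces\<close>

definition centered_plots :: "'a diffspace \<Rightarrow> 'a \<Rightarrow> 'a param set" where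
  "centered_plots X x = {(n, U, P) \<in> plots X. (\<lambda>_. 0) \<in> U \<and> P (\<lambda>_. 0) = x}"

text \<open>\<open>F\<close>, defined on \<open>W\<close>, represents a germ that is a morphism between centered plots.\<close>

fun plot_morphism :: "'a param \<Rightarrow> 'a param \<Rightarrow> rvec set \<Rightarrow> (rvec \<Rightarrow> rvec) \<Rightarrow> bool" where
  "plot_morphism (m, V, Q) (n, U, P) W F \<longleftrightarrow>
     openin (Euclidean_space m) W \<and> (\<lambda>_. 0) \<in> W \<and> W \<subseteq> V \<and> smooth_map m W n U F \<and>
     F (\<lambda>_. 0) = (\<lambda>_. 0) \<and> (\<forall>r\<in>W. Q r = P (F r))"

text \<open>The colimit is the quotient of the direct sum of the spaces $T_0U = R^n$, over all
  centered plots \<open>p = (n, U, P)\<close>, by the subspace spanned by the differences between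
  \<open>u\<close> in the summand of \<open>q\<close> and $dF_0(u)$ in the summand of \<open>p\<close>, for the morphisms
  \<open>F\<close> from \<open>q\<close> to \<open>p\<close>. A vector of the direct sum is stored as the finitely supported
  family of its coordinates, indexed by the pairs \<open>(p, i)\<close> with \<open>i < n\<close>.\<close>

type_synonym 'a plot_sum = "('a param \<times> nat, real) poly_mapping"

definition direct_sum :: "'a diffspace \<Rightarrow> 'a \<Rightarrow> 'a plot_sum set" where
  "direct_sum X x =
     {v. \<forall>(p, i)\<in>Poly_Mapping.keys v. p \<in> centered_plots X x \<and> i < fst p}"

definition summand :: "'a param \<Rightarrow> rvec \<Rightarrow> 'a plot_sum" where
  "summand p u = (\<Sum>i<fst p. Poly_Mapping.single (p, i) (u i))"

definition colimit_relations :: "'a diffspace \<Rightarrow> 'a \<Rightarrow> 'a plot_sum set" where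
  "colimit_relations X x =
     span {summand q u - summand p (jacobian (fst q) F (\<lambda>_. 0) u) | q p W F u.
       q \<in> centered_plots X x \<and> p \<in> centered_plots X x \<and> plot_morphism q p W F \<and>
       u \<in> topspace (Euclidean_space (fst q))}"

definition tangent_class :: "'a diffspace \<Rightarrow> 'a \<Rightarrow> 'a plot_sum \<Rightarrow> 'a plot_sum set" where
  "tangent_class X x v = {w. w - v \<in> colimit_relations X x}"

definition tangent_space :: "'a diffspace \<Rightarrow> 'a \<Rightarrow> 'a plot_sum set set" where
  "tangent_space X x = tangent_class X x ` direct_sum X x"

definition tangent_add :: "'a plot_sum set \<Rightarrow> 'a plot_sum set \<Rightarrow> 'a plot_sum set" where
  "tangent_add A B = {a + b | a b. a \<in> A \<and> b \<in> B}"

text \<open>The relations are added so that multiplication by 0 gives the whole zero class.\<close>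

definition tangent_scale ::
    "'a diffspace \<Rightarrow> 'a \<Rightarrow> real \<Rightarrow> 'a plot_sum set \<Rightarrow> 'a plot_sum set" where
  "tangent_scale X x c A = {c *\<^sub>R a + w | a w. a \<in> A \<and> w \<in> colimit_relations X x}"

text \<open>The structure map $dP_0 : T_0U \to T_xX$.\<close>

definition plot_tangent :: "'a diffspace \<Rightarrow> 'a \<Rightarrow> 'a param \<Rightarrow> rvec \<Rightarrow> 'a plot_sum set" where
  "plot_tangent X x p u = tangent_class X x (summand p u)"

definition tangent_linear ::
    "'a diffspace \<Rightarrow> 'a \<Rightarrow> 'b diffspace \<Rightarrow> 'b \<Rightarrow> ('a plot_sum set \<Rightarrow> 'b plot_sum set) \<Rightarrow> bool" where
  "tangent_linear X x Y y L \<longleftrightarrow>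
     L \<in> tangent_space X x \<rightarrow> tangent_space Y y \<and>
     (\<forall>A\<in>tangent_space X x. \<forall>B\<in>tangent_space X x.
        L (tangent_add A B) = tangent_add (L A) (L B)) \<and>
     (\<forall>c. \<forall>A\<in>tangent_space X x. L (tangent_scale X x c A) = tangent_scale Y y c (L A))"

definition tangent_map ::
    "'a diffspace \<Rightarrow> 'b diffspace \<Rightarrow> ('a \<Rightarrow> 'b) \<Rightarrow> 'a \<Rightarrow> 'a plot_sum set \<Rightarrow> 'b plot_sum set" where
  "tangent_map X Y f x = (THE L.
     L \<in> extensional (tangent_space X x) \<and> tangent_linear X x Y (f x) L \<and>
     (\<forall>(n, U, P)\<in>centered_plots X x. \<forall>u\<in>topspace (Euclidean_space n).
        L (plot_tangent X x (n, U, P) u) =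
          plot_tangent Y (f x) (n, U, restrict (f \<circ> P) U) u))"

definition tangent_isomorphism ::
    "'a diffspace \<Rightarrow> 'a \<Rightarrow> 'b diffspace \<Rightarrow> 'b \<Rightarrow> ('a plot_sum set \<Rightarrow> 'b plot_sum set) \<Rightarrow> bool" where
  "tangent_isomorphism X x Y y L \<longleftrightarrow>
     tangent_linear X x Y y L \<and> bij_betw L (tangent_space X x) (tangent_space Y y)"


section \<open>Etale maps, immersions and embeddings\<close>

definition etale_map :: "'a diffspace \<Rightarrow> 'b diffspace \<Rightarrow> ('a \<Rightarrow> 'b) \<Rightarrow> bool" where
  "etale_map X Y f \<longleftrightarrow> f \<in> points X \<rightarrow> points Y \<and>
     (\<forall>x\<in>points X. \<exists>S T. openin (D_topology X) S \<and> x \<in> S \<and>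
        openin (D_topology Y) T \<and> f x \<in> T \<and>
        diffeomorphism (subspace_diff X S) (subspace_diff Y T) f)"

definition diffeological_etale_map :: "'a diffspace \<Rightarrow> 'b diffspace \<Rightarrow> ('a \<Rightarrow> 'b) \<Rightarrow> bool" where
  "diffeological_etale_map X Y f \<longleftrightarrow> smooth X Y f \<and>
     (\<forall>(n, U, P)\<in>plots Y. etale_map (pullback (domain_diff n U) P X f) (domain_diff n U) fst)"

definition diffeological_immersion :: "'a diffspace \<Rightarrow> 'b diffspace \<Rightarrow> ('a \<Rightarrow> 'b) \<Rightarrow> bool" where
  "diffeological_immersion X Y f \<longleftrightarrow> smooth X Y f \<and>
     (\<forall>(n, U, P)\<in>plots Y. \<forall>(r0, x0)\<in>points (pullback (domain_diff n U) P X f).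
        \<exists>S V \<rho>. openin (D_topology (pullback (domain_diff n U) P X f)) S \<and> (r0, x0) \<in> S \<and>
          openin (Euclidean_space n) V \<and> fst ` S \<subseteq> V \<and> V \<subseteq> U \<and>
          smooth (domain_diff n V) (prod_diff (domain_diff n U) X) \<rho> \<and>
          (\<forall>(r, x)\<in>S. \<rho> (fst (r, x)) = (r, x)))"

definition diffeological_embedding :: "'a diffspace \<Rightarrow> 'b diffspace \<Rightarrow> ('a \<Rightarrow> 'b) \<Rightarrow> bool" where
  "diffeological_embedding X Y f \<longleftrightarrow>
     diffeological_immersion X Y f \<and> embedding_map (D_topology X) (D_topology Y) f"

end

theory Submission
  imports Defs
begin

text \<open>
  Let \<open>\<pi> : E \<rightarrow> X\<close> be diffeological etale, \<open>P\<close> a plot of \<open>X\<close> and \<open>P r = \<pi> e\<close>. Inverting the pullback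
  \<open>P\<^sup>*\<pi>\<close> near \<open>(r, e)\<close> gives a local lift \<open>L\<close> of \<open>P\<close> with \<open>L r = e\<close>, and since its graph is D-open in
  \<open>P\<^sup>*E\<close>, a plot \<open>Q\<close> of \<open>E\<close> with \<open>\<pi> \<circ> Q = P \<circ> F\<close> agrees with \<open>L \<circ> F\<close> near any point where it does so.
  Existence of lifts makes \<open>\<pi>\<close> open and an immersion, and their uniqueness makes the stalks discrete; on
  a manifold, the lifts of inverse charts are the local inverses of \<open>\<pi>\<close>. On tangent spaces, lifting
  the centered plots of \<open>X\<close> gives an inverse of the tangent map: by uniqueness, morphisms between
  plots are morphisms between their lifts. The chain rule is needed only to see that a manifold is a
  diffeological space.
\<close>

section \<open>Calculus in Euclidean spaces of varying dimension\<close>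

text \<open>Smoothness is expressed by iterated partial derivatives in the coordinates of sequences,
  not by a differential. The existence of partial derivatives alone does not control a function
  along a curve, so the chain rule is built from the mean value theorem and the continuity of the
  partial derivatives.

  In the converse half of (ii), the chart is what turns openness of the graph of a lift in the
  pullback into openness of the image of the lift in \<open>E\<close>.

  Neither projecting a plot nor lifting it changes its dimension, and morphisms between plots keep
  their map \<open>F\<close>. Both operations therefore act on the direct sums by relabelling plots
  and leave coordinates and Jacobians alone, so no chain rule for Jacobians occurs. The composites
  of the two operations are not the identity on the direct sums: they replace a plot by one with the
  same germ at 0, and the identity germ makes the two equal in the colimit. Since the tangent map is
  given by a definite description, its existence and uniqueness have to be established as
  well.\<close>

lemma Euclidean_space_eq_top_of_set: "Euclidean_space n = top_of_set (topspace (Euclidean_space n))"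
  by (simp add: Euclidean_space_def euclidean_product_topology)

text \<open>Only the first \<open>n\<close> factors of a basic open box constrain a point of R^n,
  since the remaining coordinates vanish at \<open>x\<close> and at \<open>y\<close>. Hence the
  least of finitely many radii suffices.\<close>

lemma openin_Euclidean_box:
  assumes "openin (Euclidean_space n) U" and "x \<in> U"
  obtains d where "d > 0"
    and "\<And>y. y \<in> topspace (Euclidean_space n) \<Longrightarrow> (\<And>i. i < n \<Longrightarrow> \<bar>y i - x i\<bar> < d) \<Longrightarrow> y \<in> U"
proof -
  obtain A where A: "open A" "U = A \<inter> topspace (Euclidean_space n)"
    using assms(1) by (metis Euclidean_space_eq_top_of_set openin_open inf_commute)
  have "openin (powertop_real UNIV) A"
    using A(1) by (simp add: euclidean_product_topology)
  moreover have "x \<in> A" and xH: "\<And>i. i \<ge> n \<Longrightarrow> x i = 0"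
    using assms(2) A(2) by (auto simp: topspace_Euclidean_space)
  ultimately obtain B where B: "\<And>i. open (B i)" "x \<in> Pi\<^sub>E UNIV B" "Pi\<^sub>E UNIV B \<subseteq> A"
    unfolding openin_product_topology_alt by (metis UNIV_I open_openin)
  have "\<exists>e>0. \<forall>t. \<bar>t - x i\<bar> < e \<longrightarrow> t \<in> B i" for i
    using B(1)[of i] B(2) by (force simp: open_dist dist_real_def)
  then obtain e where e: "\<And>i. e i > 0" "\<And>i t. \<bar>t - x i\<bar> < e i \<Longrightarrow> t \<in> B i"
    by metis
  \<comment> \<open>The 1 keeps the minimum defined for \<open>n = 0\<close>.\<close>
  define d where "d = Min (insert 1 (e ` {..<n}))"
  show thesis
  proof
    show "d > 0"
      unfolding d_def using e(1) by (subst Min_gr_iff) auto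
  next
    fix y assume y: "y \<in> topspace (Euclidean_space n)" "\<And>i. i < n \<Longrightarrow> \<bar>y i - x i\<bar> < d"
    have "y i \<in> B i" for i
    proof (cases "i < n")
      case True
      then have "d \<le> e i"
        unfolding d_def by (intro Min_le) auto
      then show ?thesis
        using y(2)[OF True] e(2) by auto
    next
      case False
      then show ?thesis
        using y(1) xH[of i] e(2)[of "y i" i] e(1)[of i] by (auto simp: topspace_Euclidean_space)
    qed
    then show "y \<in> U"
      using y(1) A(2) B(3) by auto
  qed
qed

lemma eventually_openin_Euclidean_update:
  assumes "openin (Euclidean_space n) U" and "x \<in> U" and "i < n"
  shows "\<forall>\<^sub>F t in nhds (x i). x(i := t) \<in> U"
proof -
  obtain d where d: "d > 0"
    "\<And>y. y \<in> topspace (Euclidean_space n) \<Longrightarrow> (\<And>i. i < n \<Longrightarrow> \<bar>y i - x i\<bar> < d) \<Longrightarrow> y \<in> U"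
    using openin_Euclidean_box[OF assms(1,2)] by blast
  have "x \<in> topspace (Euclidean_space n)"
    using assms(1,2) openin_subset by blast
  then have "x(i := t) \<in> U" if "dist t (x i) < d" for t
    using that \<open>i < n\<close> d(1) by (intro d(2)) (auto simp: topspace_Euclidean_space dist_real_def)
  then show ?thesis
    using \<open>d > 0\<close> eventually_nhds_metric by blast
qed

lemma at_within_openin_Euclidean:
  assumes "openin (Euclidean_space n) U" and "x \<in> U"
  shows "at x within U = at x within topspace (Euclidean_space n)"
proof -
  obtain A where "open A" "U = A \<inter> topspace (Euclidean_space n)"
    using assms(1) by (metis Euclidean_space_eq_top_of_set openin_open inf_commute)
  then show ?thesis
    using assms(2) by (intro at_within_nhd[of x A]) auto
qed

lemma openin_Euclidean_preimage:
  assumes "openin (Euclidean_space n) U" and "continuous_on U f" and "open A"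
  shows "openin (Euclidean_space n) {x \<in> U. f x \<in> A}"
proof -
  have "openin (top_of_set U) (U \<inter> f -` A)"
    using assms(2,3) by (simp add: continuous_openin_preimage_gen)
  then have "openin (Euclidean_space n) (U \<inter> f -` A)"
    using assms(1) by (metis Euclidean_space_eq_top_of_set openin_trans)
  then show ?thesis
    by (simp add: vimage_def Collect_conj_eq)
qed

section \<open>Functions of class C^k and their partial derivatives\<close>

text \<open>This is the derivative clause of \<open>Ck\<close> under a name. With
  \<open>Ck_Suc\<close> in place of the recursion equation, partial derivatives can be passed around
  as a relation between two functions.\<close>

definition has_partial_on :: "(rvec \<Rightarrow> real) \<Rightarrow> (rvec \<Rightarrow> real) \<Rightarrow> nat \<Rightarrow> rvec set \<Rightarrow> bool" where
  "has_partial_on g h i U \<longleftrightarrow> (\<forall>x\<in>U. ((\<lambda>t. g (x(i := t))) has_real_derivative h x) (at (x i)))"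

lemma has_partial_onD:
  "has_partial_on g h i U \<Longrightarrow> x \<in> U \<Longrightarrow> ((\<lambda>t. g (x(i := t))) has_real_derivative h x) (at (x i))"
  by (simp add: has_partial_on_def)

lemma has_partial_on_subset: "has_partial_on g h i U \<Longrightarrow> V \<subseteq> U \<Longrightarrow> has_partial_on g h i V"
  by (auto simp: has_partial_on_def)

text \<open>A derivative at \<open>x\<close> sees values off \<open>x\<close>; openness of
  \<open>U\<close> keeps the nearby part of the coordinate line inside \<open>U\<close>, where the
  functions agree.\<close>

lemma has_partial_on_cong:
  assumes "openin (Euclidean_space n) U" and "i < n" and eq: "\<And>x. x \<in> U \<Longrightarrow> f x = g x"
    and f: "has_partial_on f h i U"
  shows "has_partial_on g h i U"
  unfolding has_partial_on_def
proof
  fix x assume "x \<in> U"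
  have "\<forall>\<^sub>F t in nhds (x i). f (x(i := t)) = g (x(i := t))"
    using eventually_openin_Euclidean_update[OF assms(1) \<open>x \<in> U\<close> assms(2)]
    by (rule eventually_mono) (rule eq)
  from DERIV_cong_ev[OF refl this refl] show "((\<lambda>t. g (x(i := t))) has_real_derivative h x) (at (x i))"
    using has_partial_onD[OF f \<open>x \<in> U\<close>] by simp
qed

lemma Ck_Suc:
  "Ck n (Suc k) U g \<longleftrightarrow> continuous_on U g \<and> (\<forall>i<n. \<exists>h. has_partial_on g h i U \<and> Ck n k U h)"
  by (simp add: has_partial_on_def)

declare Ck.simps(2) [simp del]

lemma Ck_imp_continuous_on: "Ck n k U g \<Longrightarrow> continuous_on U g"
  by (cases k) (auto simp: Ck_Suc)

lemma Ck_cong: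
  assumes U: "openin (Euclidean_space n) U" and eq: "\<And>x. x \<in> U \<Longrightarrow> f x = g x"
    and f: "Ck n k U f"
  shows "Ck n k U g"
proof -
  have "continuous_on U g"
    using Ck_imp_continuous_on[OF f] eq continuous_on_eq by blast
  moreover have "has_partial_on g h i U" if "i < n" "has_partial_on f h i U" for i h
    using has_partial_on_cong[OF U that(1) eq that(2)] .
  ultimately show ?thesis
    using f by (cases k) (auto simp: Ck_Suc, metis)
qed

lemma Ck_subset: "Ck n k U g \<Longrightarrow> V \<subseteq> U \<Longrightarrow> Ck n k V g"
proof (induction k arbitrary: g)
  case (Suc k)
  then show ?case
    unfolding Ck_Suc by (meson continuous_on_subset has_partial_on_subset)
qed (auto intro: continuous_on_subset)

lemma Ck_SucD: "Ck n (Suc k) U g \<Longrightarrow> Ck n k U g"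
proof (induction k arbitrary: g)
  case (Suc k)
  then show ?case
    unfolding Ck_Suc[of n "Suc k"] Ck_Suc[of n k U g] by meson
qed (simp add: Ck_Suc)

text \<open>The partial derivatives given on the various neighbourhoods have to come from one
  function on \<open>U\<close>. By uniqueness of derivatives, \<open>deriv\<close> along the
  coordinate line agrees with all of them, and the induction hypothesis applies to it.\<close>

lemma Ck_local:
  assumes U: "openin (Euclidean_space n) U"
    and loc: "\<And>x. x \<in> U \<Longrightarrow> \<exists>V. openin (Euclidean_space n) V \<and> x \<in> V \<and> V \<subseteq> U \<and> Ck n k V g"
  shows "Ck n k U g"
  using loc
proof (induction k arbitrary: g)
  case 0
  have "continuous (at x within U) g" if "x \<in> U" for x
  proof -
    obtain V where V: "openin (Euclidean_space n) V" "x \<in> V" "continuous_on V g"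
      using 0 \<open>x \<in> U\<close> by auto
    then have "continuous (at x within V) g"
      by (simp add: continuous_on_eq_continuous_within)
    then show ?thesis
      using U V that by (simp add: at_within_openin_Euclidean)
  qed
  then show ?case
    by (simp add: continuous_on_eq_continuous_within)
next
  case (Suc k)
  define h where "h i x = deriv (\<lambda>t. g (x(i := t))) (x i)" for i x
  have *: "has_partial_on g (h i) i V \<and> Ck n k V (h i)"
    if V: "openin (Euclidean_space n) V" and "Ck n (Suc k) V g" "i < n" for V i
  proof -
    obtain h' where h': "has_partial_on g h' i V" "Ck n k V h'"
      using \<open>Ck n (Suc k) V g\<close> \<open>i < n\<close> unfolding Ck_Suc by blast
    have eq: "h' x = h i x" if "x \<in> V" for x
      unfolding h_def using DERIV_imp_deriv[OF has_partial_onD[OF h'(1) that]] by simp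
    have "has_partial_on g (h i) i V"
      using h'(1) unfolding has_partial_on_def by (simp add: eq)
    then show ?thesis
      using Ck_cong[OF V eq h'(2)] by simp
  qed
  have "Ck n k U g"
    by (rule Suc.IH) (meson Suc.prems Ck_SucD)
  then have "continuous_on U g"
    by (rule Ck_imp_continuous_on)
  moreover have "Ck n k U (h i)" if "i < n" for i
    by (rule Suc.IH) (meson Suc.prems * that)
  moreover have "has_partial_on g (h i) i U" if "i < n" for i
    unfolding has_partial_on_def
  proof
    fix x assume "x \<in> U"
    then obtain V where "openin (Euclidean_space n) V" "x \<in> V" "Ck n (Suc k) V g"
      using Suc.prems by blast
    then show "((\<lambda>t. g (x(i := t))) has_real_derivative h i x) (at (x i))"
      using * that has_partial_onD[of g "h i" i V x] by simp
  qed
  ultimately show ?case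
    unfolding Ck_Suc by blast
qed

lemma Ck_const: "Ck n k U (\<lambda>x. c)"
proof (induction k arbitrary: c)
  case (Suc k)
  have "has_partial_on (\<lambda>x. c) (\<lambda>x. 0) i U" for i
    by (simp add: has_partial_on_def)
  moreover have "continuous_on U (\<lambda>x. c)"
    by (rule continuous_on_const)
  ultimately show ?case
    unfolding Ck_Suc using Suc by blast
qed (simp add: continuous_on_const)

lemma Ck_coordinate: "Ck n k U (\<lambda>x. x j)"
proof -
  have "continuous_on U (\<lambda>x :: rvec. x j)"
    by (rule continuous_on_subset[OF continuous_on_product_coordinates subset_UNIV])
  moreover have "has_partial_on (\<lambda>x. x j) (\<lambda>_. if i = j then 1 else 0) i U" for i
    by (cases "i = j") (auto simp: has_partial_on_def)
  ultimately show ?thesis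
    unfolding Ck.simps Ck_Suc using Ck_const by (cases k) (simp_all only: Ck.simps(1) Ck_Suc, blast)
qed

lemma Ck_add: "Ck n k U f \<Longrightarrow> Ck n k U g \<Longrightarrow> Ck n k U (\<lambda>x. f x + g x)"
proof (induction k arbitrary: f g)
  case (Suc k)
  have "\<exists>h. has_partial_on (\<lambda>x. f x + g x) h i U \<and> Ck n k U h"
    if i: "i < n" for i
  proof -
    obtain f' g' where *: "has_partial_on f f' i U" "Ck n k U f'" "has_partial_on g g' i U" "Ck n k U g'"
      using Suc.prems i unfolding Ck_Suc by blast
    then have "has_partial_on (\<lambda>x. f x + g x) (\<lambda>x. f' x + g' x) i U"
      unfolding has_partial_on_def by (auto intro!: derivative_intros)
    then show ?thesis
      using Suc.IH * by blast
  qed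
  then show ?case
    using Suc.prems unfolding Ck_Suc by (blast intro: continuous_on_add)
qed (auto intro: continuous_intros)

lemma Ck_mult: "Ck n k U f \<Longrightarrow> Ck n k U g \<Longrightarrow> Ck n k U (\<lambda>x. f x * g x)"
proof (induction k arbitrary: f g)
  case (Suc k)
  have "\<exists>h. has_partial_on (\<lambda>x. f x * g x) h i U \<and> Ck n k U h"
    if i: "i < n" for i
  proof -
    obtain f' g' where *: "has_partial_on f f' i U" "Ck n k U f'" "has_partial_on g g' i U" "Ck n k U g'"
      using Suc.prems i unfolding Ck_Suc by blast
    have "has_partial_on (\<lambda>x. f x * g x) (\<lambda>x. f' x * g x + g' x * f x) i U"
      unfolding has_partial_on_def
    proof
      fix x assume "x \<in> U"
      show "((\<lambda>t. f (x(i := t)) * g (x(i := t))) has_real_derivative f' x * g x + g' x * f x) (at (x i))"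
        using DERIV_mult[OF *(1,3)[THEN has_partial_onD, OF \<open>x \<in> U\<close>]] by simp
    qed
    \<comment> \<open>The Leibniz formula contains the undifferentiated factors, which are known to
      order \<open>Suc k\<close> and are used to order \<open>k\<close>.\<close>
    moreover have "Ck n k U (\<lambda>x. f' x * g x + g' x * f x)"
      using * Suc.prems[THEN Ck_SucD] by (intro Ck_add Suc.IH)
    ultimately show ?thesis
      by blast
  qed
  then show ?case
    using Suc.prems unfolding Ck_Suc by (blast intro: continuous_on_mult)
qed (auto intro: continuous_intros)

lemma Ck_sum:
  assumes "\<And>i. i \<in> I \<Longrightarrow> Ck n k U (f i)"
  shows "Ck n k U (\<lambda>x. \<Sum>i\<in>I. f i x)"
  using assms by (induction I rule: infinite_finite_induct) (simp_all add: Ck_const Ck_add)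

section \<open>The chain rule\<close>

text \<open>A coordinate of a curve may move to either side of its initial value or return to it.
  The mean value theorem is therefore put in a form that treats both orders of \<open>a\<close> and
  \<open>b\<close>, and \<open>a = b\<close>, alike.\<close>

lemma mean_value_unordered:
  fixes f :: "real \<Rightarrow> real"
  assumes "\<And>x. \<bar>x - a\<bar> \<le> \<bar>b - a\<bar> \<Longrightarrow> (f has_real_derivative f' x) (at x)"
  obtains z where "\<bar>z - a\<bar> \<le> \<bar>b - a\<bar>" and "f b - f a = f' z * (b - a)"
proof (cases a b rule: linorder_cases)
  case less
  obtain z where "a < z" "z < b" "f b - f a = (b - a) * f' z"
    using MVT2[OF less, of f f'] assms less by auto
  then show thesis
    using that[of z] by (simp add: mult.commute)
next
  case equal
  then show thesis
    using that[of a] by simp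
next
  case greater
  obtain z where "b < z" "z < a" "f a - f b = (a - b) * f' z"
    using MVT2[OF greater, of f f'] assms greater by auto
  then show thesis
    using that[of z] by (simp add: algebra_simps)
qed

text \<open>The coordinates of the curve are switched on one at a time, and each increment is
  controlled by the mean value theorem and the continuity of one partial derivative.\<close>

lemma DERIV_along_curve:
  fixes c :: "real \<Rightarrow> rvec"
  assumes U: "openin (Euclidean_space n) U" and c0: "c t0 \<in> U" and cU: "\<forall>\<^sub>F t in nhds t0. c t \<in> U"
    and c: "\<And>j. j < n \<Longrightarrow> ((\<lambda>t. c t j) has_real_derivative c' j) (at t0)"
    and g: "\<And>j x. j < n \<Longrightarrow> x \<in> U \<Longrightarrow> ((\<lambda>t. g (x(j := t))) has_real_derivative h j x) (at (x j))"
    and h: "\<And>j. j < n \<Longrightarrow> continuous_on U (h j)"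
  shows "((\<lambda>t. g (c t)) has_real_derivative (\<Sum>j<n. h j (c t0) * c' j)) (at t0)"
proof -
  define z where "z j t = (\<lambda>i. if i < j then c t i else c t0 i)" for j t
  have c0H: "c t0 i = 0" if "i \<ge> n" for i
    using c0 U openin_subset that by (force simp: topspace_Euclidean_space)
  have "((\<lambda>t. g (z k t)) has_real_derivative (\<Sum>j<k. h j (c t0) * c' j)) (at t0)" if "k \<le> n" for k
    using that
  proof (induction k)
    case 0
    then show ?case
      by (simp add: z_def)
  next
    case (Suc k)
    then have k: "k < n" by simp
    define D where "D t = g ((z k t)(k := c t k)) - g (z k t)" for t
    \<comment> \<open>When \<open>c t k\<close> equals \<open>c t0 k\<close> the difference quotient
      is meaningless. The value \<open>h k (c t0)\<close> keeps
      \<open>D t = q t * (c t k - c t0 k)\<close> true for every \<open>t\<close>, and it is the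
      limit at \<open>t0\<close>, so \<open>q\<close> is continuous there.\<close>
    define q where "q t = (if c t k = c t0 k then h k (c t0) else D t / (c t k - c t0 k))" for t
    have zt0: "z k t0 = c t0"
      by (simp add: z_def fun_eq_iff)
    have D: "D t = q t * (c t k - c t0 k)" for t
      using zt0 by (auto simp: q_def D_def z_def fun_upd_idem)
    have "q \<midarrow>t0\<rightarrow> h k (c t0)"
    proof (rule tendstoI)
      fix e :: real assume "e > 0"
      have "openin (Euclidean_space n) {x \<in> U. h k x \<in> ball (h k (c t0)) e}"
        using U h[OF k] by (intro openin_Euclidean_preimage) auto
      then obtain d where d: "d > 0"
        "\<And>y. y \<in> topspace (Euclidean_space n) \<Longrightarrow> (\<And>i. i < n \<Longrightarrow> \<bar>y i - c t0 i\<bar> < d)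
          \<Longrightarrow> y \<in> {x \<in> U. h k x \<in> ball (h k (c t0)) e}"
        by (rule openin_Euclidean_box) (use c0 \<open>e > 0\<close> in auto)
      have "\<forall>\<^sub>F t in at t0. \<forall>i\<in>{..<n}. dist (c t i) (c t0 i) < d"
        using DERIV_isCont[OF c] d(1)
        by (intro eventually_ball_finite) (auto intro!: tendstoD simp: isCont_def)
      then show "\<forall>\<^sub>F t in at t0. dist (q t) (h k (c t0)) < e"
      proof (rule eventually_mono)
        fix t assume t: "\<forall>i\<in>{..<n}. dist (c t i) (c t0 i) < d"
        \<comment> \<open>The intermediate points mix coordinates of \<open>c t\<close> and
          \<open>c t0\<close>, so \<open>c t\<close> lying in \<open>U\<close> says nothing about
          them; the box around \<open>c t0\<close> does.\<close>
        have box: "(z k t)(k := s) \<in> {x \<in> U. h k x \<in> ball (h k (c t0)) e}"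
          if s: "\<bar>s - c t0 k\<bar> \<le> \<bar>c t k - c t0 k\<bar>" for s
        proof (rule d(2))
          show "(z k t)(k := s) \<in> topspace (Euclidean_space n)"
            using c0H k by (auto simp: z_def topspace_Euclidean_space)
        next
          fix i assume "i < n"
          then show "\<bar>((z k t)(k := s)) i - c t0 i\<bar> < d"
            using t s k d(1) by (force simp: z_def dist_real_def)
        qed
        have "((\<lambda>s. g ((z k t)(k := s))) has_real_derivative h k ((z k t)(k := s))) (at s)"
          if "\<bar>s - c t0 k\<bar> \<le> \<bar>c t k - c t0 k\<bar>" for s
          using g[OF k, of "(z k t)(k := s)"] box[OF that] by simp
        then obtain s where s: "\<bar>s - c t0 k\<bar> \<le> \<bar>c t k - c t0 k\<bar>"
          "g ((z k t)(k := c t k)) - g ((z k t)(k := c t0 k)) = h k ((z k t)(k := s)) * (c t k - c t0 k)"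
          using mean_value_unordered[of "c t0 k" "c t k" "\<lambda>s. g ((z k t)(k := s))" "\<lambda>s. h k ((z k t)(k := s))"]
          by blast
        have "(z k t)(k := c t0 k) = z k t"
          by (auto simp: z_def)
        then have "D t = h k ((z k t)(k := s)) * (c t k - c t0 k)"
          using s(2) by (simp add: D_def)
        then have "q t = h k ((z k t)(k := s)) \<or> q t = h k (c t0)"
          by (auto simp: q_def)
        then show "dist (q t) (h k (c t0)) < e"
          using box[OF s(1)] \<open>e > 0\<close> by (auto simp: dist_commute)
      qed
    qed
    then have q: "isCont q t0"
      by (simp add: isCont_def q_def)
    \<comment> \<open>Caratheodory's form of the derivative multiplies slopes and never divides by
      \<open>c t k - c t0 k\<close>, which may vanish arbitrarily close to
      \<open>t0\<close>.\<close>
    obtain \<gamma> where \<gamma>: "\<And>t. c t k - c t0 k = \<gamma> t * (t - t0)" "isCont \<gamma> t0" "\<gamma> t0 = c' k"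
      using c[OF k] unfolding CARAT_DERIV by blast
    have "(D has_real_derivative h k (c t0) * c' k) (at t0)"
      unfolding CARAT_DERIV
    proof (intro exI conjI allI)
      show "D t - D t0 = (q t * \<gamma> t) * (t - t0)" for t
        using D[of t] D[of t0] \<gamma>(1)[of t] by simp
      show "isCont (\<lambda>t. q t * \<gamma> t) t0"
        using q \<gamma>(2) by (intro continuous_intros)
      show "q t0 * \<gamma> t0 = h k (c t0) * c' k"
        using \<gamma>(3) by (simp add: q_def)
    qed
    moreover have "z (Suc k) t = (z k t)(k := c t k)" for t
      by (auto simp: z_def)
    then have "g (z (Suc k) t) = g (z k t) + D t" for t
      by (simp add: D_def)
    ultimately show ?case
      using DERIV_add Suc by fastforce
  qed
  then have "((\<lambda>t. g (z n t)) has_real_derivative (\<Sum>j<n. h j (c t0) * c' j)) (at t0)"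
    by blast
  \<comment> \<open>From index \<open>n\<close> on, \<open>z n t\<close> has the coordinates of
    \<open>c t0\<close>, which are 0. Those of \<open>c t\<close> are known to be 0 once
    \<open>c t\<close> lies in \<open>U\<close>, hence an equality near \<open>t0\<close>.\<close>
  moreover have "\<forall>\<^sub>F t in nhds t0. g (z n t) = g (c t)"
    using cU
  proof (rule eventually_mono)
    fix t assume "c t \<in> U"
    then have "c t i = 0" if "i \<ge> n" for i
      using U openin_subset that by (force simp: topspace_Euclidean_space)
    then have "z n t = c t"
      using c0H by (force simp: z_def)
    then show "g (z n t) = g (c t)"
      by simp
  qed
  ultimately show ?thesis
    using DERIV_cong_ev[OF refl _ refl] by metis
qed

text \<open>The product topology tests every coordinate, and those from \<open>n\<close> on vanish
  on R^n.\<close>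

lemma continuous_on_into_Euclidean:
  assumes "openin (Euclidean_space n) V" and "F \<in> U \<rightarrow> V"
    and "\<And>j. j < n \<Longrightarrow> continuous_on U (\<lambda>x. F x j)"
  shows "continuous_on U F"
proof (rule continuous_on_coordinatewise_then_product)
  fix j
  have "F x j = 0" if "x \<in> U" "j \<ge> n" for x
    using assms(1,2) openin_subset that by (force simp: topspace_Euclidean_space)
  then show "continuous_on U (\<lambda>x. F x j)"
    using assms(3) by (cases "j < n") (auto intro: continuous_on_eq[of U "\<lambda>_. 0"])
qed

text \<open>The induction is on the order, with the outer function varying. A partial derivative of
  the composite is a sum of products of \<open>h j \<circ> F\<close>, to which the induction
  hypothesis applies, with partial derivatives of the components of \<open>F\<close>.\<close>

lemma Ck_compose:
  assumes U: "openin (Euclidean_space m) U" and V: "openin (Euclidean_space n) V" and FV: "F \<in> U \<rightarrow> V"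
  shows "(\<And>j. j < n \<Longrightarrow> Ck m k U (\<lambda>x. F x j)) \<Longrightarrow> Ck n k V g \<Longrightarrow> Ck m k U (\<lambda>x. g (F x))"
proof (induction k arbitrary: g)
  case 0
  then have "continuous_on U F"
    using V FV by (intro continuous_on_into_Euclidean) auto
  then show ?case
    using 0(2) FV continuous_on_compose2[of V g U F] by auto
next
  case (Suc k)
  have "\<exists>h. \<forall>j<n. has_partial_on g (h j) j V \<and> Ck n k V (h j)"
    using Suc.prems(2) unfolding Ck_Suc by metis
  then obtain h where h: "\<forall>j<n. has_partial_on g (h j) j V \<and> Ck n k V (h j)"
    by (elim exE)
  have "\<exists>h. has_partial_on (\<lambda>x. g (F x)) h i U \<and> Ck m k U h"
    if i: "i < m" for i
  proof -
    have "\<forall>j. \<exists>f. j < n \<longrightarrow> has_partial_on (\<lambda>x. F x j) f i U \<and> Ck m k U f"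
    proof (intro allI)
      fix j
      show "\<exists>f. j < n \<longrightarrow> has_partial_on (\<lambda>x. F x j) f i U \<and> Ck m k U f"
        using Suc.prems(1)[of j] i by (cases "j < n") (simp_all add: Ck_Suc)
    qed
    then have "\<exists>f. \<forall>j<n. has_partial_on (\<lambda>x. F x j) (f j) i U \<and> Ck m k U (f j)"
      by (rule choice)
    then obtain f where f: "\<forall>j<n. has_partial_on (\<lambda>x. F x j) (f j) i U \<and> Ck m k U (f j)"
      by (elim exE)
    have "has_partial_on (\<lambda>x. g (F x)) (\<lambda>x. \<Sum>j<n. h j (F x) * f j x) i U"
      unfolding has_partial_on_def
    proof
      fix x assume x: "x \<in> U"
      \<comment> \<open>The curve is the image under \<open>F\<close> of the line through
        \<open>x\<close> in direction \<open>i\<close>.\<close>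
      have "((\<lambda>t. g (F (x(i := t)))) has_real_derivative (\<Sum>j<n. h j (F (x(i := x i))) * f j x)) (at (x i))"
      proof (rule DERIV_along_curve[OF V])
        show "\<forall>\<^sub>F t in nhds (x i). F (x(i := t)) \<in> V"
          using eventually_openin_Euclidean_update[OF U x i]
          by (rule eventually_mono) (use FV in auto)
        show "((\<lambda>t. F (x(i := t)) j) has_real_derivative f j x) (at (x i))" if "j < n" for j
          using f that has_partial_onD[OF _ x, of "\<lambda>x. F x j" "f j" i] by simp
        show "((\<lambda>t. g (y(j := t))) has_real_derivative h j y) (at (y j))" if "j < n" "y \<in> V" for j y
          using h that has_partial_onD[of g "h j" j V y] by simp
        show "continuous_on V (h j)" if "j < n" for j
          using h that Ck_imp_continuous_on[of n k V "h j"] by simp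
      qed (use x FV in auto)
      then show "((\<lambda>t. g (F (x(i := t)))) has_real_derivative (\<Sum>j<n. h j (F x) * f j x)) (at (x i))"
        by simp
    qed
    moreover have "Ck m k U (\<lambda>x. \<Sum>j<n. h j (F x) * f j x)"
    proof (rule Ck_sum)
      fix j assume "j \<in> {..<n}"
      then have j: "j < n" by simp
      have "Ck m k U (\<lambda>x. h j (F x))"
        by (rule Suc.IH) (use Suc.prems(1) Ck_SucD h j in blast)+
      then show "Ck m k U (\<lambda>x. h j (F x) * f j x)"
        using f j by (simp add: Ck_mult)
    qed
    ultimately show ?thesis
      by (intro exI[of _ "\<lambda>x. \<Sum>j<n. h j (F x) * f j x"] conjI)
  qed
  moreover have "Ck m k U (\<lambda>x. g (F x))"
    by (rule Suc.IH) (use Suc.prems Ck_SucD in blast)+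
  then have "continuous_on U (\<lambda>x. g (F x))"
    by (rule Ck_imp_continuous_on)
  ultimately show ?case
    by (simp add: Ck_Suc)
qed

section \<open>Smooth maps between domains\<close>

lemma smooth_map_mem: "smooth_map n U m V F \<Longrightarrow> x \<in> U \<Longrightarrow> F x \<in> V"
  by (auto simp: smooth_map_def)

lemma smooth_map_Ck: "smooth_map n U m V F \<Longrightarrow> j < m \<Longrightarrow> Ck n k U (\<lambda>x. F x j)"
  by (simp add: smooth_map_def)

lemma smooth_map_continuous_on:
  assumes "openin (Euclidean_space m) V" and "smooth_map n U m V F"
  shows "continuous_on U F"
proof (rule continuous_on_into_Euclidean[OF assms(1)])
  show "F \<in> U \<rightarrow> V"
    using assms(2) by (simp add: smooth_map_def)
  show "continuous_on U (\<lambda>x. F x j)" if "j < m" for j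
    using smooth_map_Ck[OF assms(2) that, of 0] by simp
qed

lemma smooth_map_openin_preimage:
  assumes U: "openin (Euclidean_space n) U" and V: "openin (Euclidean_space m) V"
    and F: "smooth_map n U m V F" and W: "openin (Euclidean_space m) W"
  shows "openin (Euclidean_space n) {x \<in> U. F x \<in> W}"
proof -
  obtain A where A: "open A" "W = A \<inter> topspace (Euclidean_space m)"
    using W by (metis Euclidean_space_eq_top_of_set openin_open inf_commute)
  have "F x \<in> topspace (Euclidean_space m)" if "x \<in> U" for x
    using smooth_map_mem[OF F that] openin_subset[OF V] by blast
  then have "{x \<in> U. F x \<in> W} = {x \<in> U. F x \<in> A}"
    using A(2) by auto
  then show ?thesis
    using openin_Euclidean_preimage[OF U smooth_map_continuous_on[OF V F] A(1)] by simp
qed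

lemma smooth_map_inclusion: "U \<subseteq> V \<Longrightarrow> smooth_map n U n V (\<lambda>x. x)"
  by (auto simp: smooth_map_def Ck_coordinate)

lemma smooth_map_const: "c \<in> V \<Longrightarrow> smooth_map n U m V (\<lambda>x. c)"
  by (auto simp: smooth_map_def Ck_const)

lemma smooth_map_subset:
  "smooth_map n U m V F \<Longrightarrow> U' \<subseteq> U \<Longrightarrow> F \<in> U' \<rightarrow> V' \<Longrightarrow> smooth_map n U' m V' F"
  unfolding smooth_map_def by (meson Ck_subset)

lemma smooth_map_cong:
  assumes "openin (Euclidean_space n) U" and "\<And>x. x \<in> U \<Longrightarrow> F x = G x" and "smooth_map n U m V F"
  shows "smooth_map n U m V G"
  unfolding smooth_map_def
proof (intro conjI allI impI)
  show "G \<in> U \<rightarrow> V"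
    using assms(2) smooth_map_mem[OF assms(3)] by auto
  show "Ck n k U (\<lambda>x. G x j)" if "j < m" for j k
    by (rule Ck_cong[OF assms(1) _ smooth_map_Ck[OF assms(3) that]]) (simp add: assms(2))
qed

text \<open>Parametrizations are stored as restricted functions, whereas smoothness on an open set
  depends only on the values there. This removes the restriction.\<close>

lemma smooth_map_restrict_iff:
  assumes "openin (Euclidean_space n) U"
  shows "smooth_map n U m V (restrict F U) \<longleftrightarrow> smooth_map n U m V F"
  using smooth_map_cong[OF assms, of F "restrict F U"] smooth_map_cong[OF assms, of "restrict F U" F]
  by auto

lemma smooth_map_compose:
  assumes "openin (Euclidean_space n) U" and "openin (Euclidean_space m) V"
    and F: "smooth_map n U m V F" and G: "smooth_map m V p W G"
  shows "smooth_map n U p W (\<lambda>x. G (F x))"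
  unfolding smooth_map_def
proof (intro conjI allI impI)
  show "(\<lambda>x. G (F x)) \<in> U \<rightarrow> W"
    using smooth_map_mem[OF F] smooth_map_mem[OF G] by auto
  fix j k assume "j < p"
  have FV: "F \<in> U \<rightarrow> V"
    using F by (simp add: smooth_map_def)
  show "Ck n k U (\<lambda>x. G (F x) j)"
    by (rule Ck_compose[OF assms(1,2) FV smooth_map_Ck[OF F] smooth_map_Ck[OF G \<open>j < p\<close>]])
qed

lemma smooth_map_local:
  assumes U: "openin (Euclidean_space n) U"
    and loc: "\<And>x. x \<in> U \<Longrightarrow>
      \<exists>W. openin (Euclidean_space n) W \<and> x \<in> W \<and> W \<subseteq> U \<and> smooth_map n W m V F"
  shows "smooth_map n U m V F"
  unfolding smooth_map_def
proof (intro conjI allI impI)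
  show "F \<in> U \<rightarrow> V"
    using loc smooth_map_mem by (intro Pi_I) blast
  show "Ck n k U (\<lambda>x. F x j)" if "j < m" for j k
  proof (rule Ck_local[OF U])
    fix x assume "x \<in> U"
    then obtain W where "openin (Euclidean_space n) W" "x \<in> W" "W \<subseteq> U" "smooth_map n W m V F"
      using loc by blast
    then show "\<exists>W. openin (Euclidean_space n) W \<and> x \<in> W \<and> W \<subseteq> U \<and> Ck n k W (\<lambda>x. F x j)"
      using smooth_map_Ck[OF \<open>smooth_map n W m V F\<close> that] by (intro exI[of _ W] conjI)
  qed
qed


section \<open>Plots\<close>

lemma plotD:
  assumes "diffeological_space X" and "(n, U, P) \<in> plots X"
  shows "openin (Euclidean_space n) U" and "P \<in> U \<rightarrow>\<^sub>E points X"
  using assms by (auto simp: diffeological_space_def parametrizations_def)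

lemma plot_compose:
  assumes "diffeological_space X" and "(n, U, P) \<in> plots X"
    and "openin (Euclidean_space m) V" and "smooth_map m V n U F"
  shows "(m, V, restrict (P \<circ> F) V) \<in> plots X"
proof -
  have "\<forall>(n, U, P)\<in>plots X. \<forall>m V F. openin (Euclidean_space m) V \<and> smooth_map m V n U F
          \<longrightarrow> (m, V, restrict (P \<circ> F) V) \<in> plots X"
    using assms(1) unfolding diffeological_space_def by (elim conjE)
  from bspec[OF this assms(2)] show ?thesis
    using assms(3,4) by simp
qed

lemma plot_subset:
  assumes "diffeological_space X" and "(n, U, P) \<in> plots X"
    and "openin (Euclidean_space n) V" and "V \<subseteq> U"
  shows "(n, V, restrict P V) \<in> plots X"
  using plot_compose[OF assms(1-3) smooth_map_inclusion[OF assms(4)]] by (simp add: comp_def)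

text \<open>This is the gluing axiom for the family of all restrictions of \<open>P\<close> that are
  plots; restrictions of one function agree on overlaps.\<close>

lemma plot_local:
  assumes X: "diffeological_space X" and P: "P \<in> extensional U"
    and loc: "\<And>r. r \<in> U \<Longrightarrow> \<exists>V. r \<in> V \<and> V \<subseteq> U \<and> (n, V, restrict P V) \<in> plots X"
  shows "(n, U, P) \<in> plots X"
proof -
  define S where "S = {(V, Q). V \<subseteq> U \<and> Q = restrict P V \<and> (n, V, Q) \<in> plots X}"
  have US: "(\<Union>(V, Q)\<in>S. V) = U"
  proof (intro equalityI subsetI)
    fix r assume "r \<in> U"
    then obtain V where "r \<in> V" "V \<subseteq> U" "(n, V, restrict P V) \<in> plots X"
      using loc by blast
    then show "r \<in> (\<Union>(V, Q)\<in>S. V)"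
      by (intro UN_I[of "(V, restrict P V)"]) (simp_all add: S_def)
  qed (auto simp: S_def)
  have "(n, \<Union>(V, Q)\<in>S. V, P) \<in> plots X"
  proof -
    have "\<forall>n S P. (\<forall>(U, Q)\<in>S. (n, U, Q) \<in> plots X) \<and>
        (\<forall>(U, Q)\<in>S. \<forall>(V, R)\<in>S. \<forall>r\<in>U \<inter> V. Q r = R r) \<and>
        P \<in> extensional (\<Union>(U, Q)\<in>S. U) \<and> (\<forall>(U, Q)\<in>S. \<forall>r\<in>U. P r = Q r)
          \<longrightarrow> (n, (\<Union>(U, Q)\<in>S. U), P) \<in> plots X"
      using X unfolding diffeological_space_def by (elim conjE)
    from this[rule_format, of S n P] show ?thesis
      using P US by (auto simp: S_def)
  qed
  then show ?thesis
    by (simp only: US)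
qed

text \<open>The covering axiom gives some plot through \<open>x\<close>, and a constant map into its
  domain is smooth.\<close>

lemma plot_const:
  assumes X: "diffeological_space X" and "x \<in> points X" and V: "openin (Euclidean_space m) V"
  shows "(m, V, restrict (\<lambda>_. x) V) \<in> plots X"
proof -
  have "x \<in> (\<Union>(n, U, P)\<in>plots X. P ` U)"
    using assms(1,2) unfolding diffeological_space_def by blast
  then obtain n U P r where "(n, U, P) \<in> plots X" "r \<in> U" "P r = x"
    by auto
  then show ?thesis
    using plot_compose[OF X _ V smooth_map_const[of r U]] by (fastforce simp: comp_def)
qed

lemma D_open_preimage:
  "D_open X A \<Longrightarrow> (n, U, P) \<in> plots X \<Longrightarrow> openin (Euclidean_space n) {r \<in> U. P r \<in> A}"
  by (auto simp: D_open_def)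

lemma plot_into_D_open:
  assumes X: "diffeological_space X" and A: "D_open X A" and P: "(n, U, P) \<in> plots X"
  shows "(n, {r \<in> U. P r \<in> A}, restrict P {r \<in> U. P r \<in> A}) \<in> plots (subspace_diff X A)"
  using plot_subset[OF X P D_open_preimage[OF A P]] by (auto simp: subspace_diff_def)

lemma topspace_D_topology:
  assumes "diffeological_space X"
  shows "topspace (D_topology X) = points X"
proof -
  have "D_open X (points X)"
    unfolding D_open_def
  proof (intro conjI ballI, simp, clarify)
    fix n U P assume "(n, U, P) \<in> plots X"
    then have "openin (Euclidean_space n) U" "P \<in> U \<rightarrow>\<^sub>E points X"
      using plotD[OF assms] by blast+
    moreover from this have "{r \<in> U. P r \<in> points X} = U"
      by auto
    ultimately    show "openin (Euclidean_space n) {r \<in> U. P r \<in> points X}"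
      by simp
  qed
  then show ?thesis
    unfolding topspace_def openin_D_topology by (auto simp: D_open_def)
qed

lemma smooth_imp_continuous_map:
  assumes X: "diffeological_space X" and Y: "diffeological_space Y" and f: "smooth X Y f"
  shows "continuous_map (D_topology X) (D_topology Y) f"
  unfolding continuous_map topspace_D_topology[OF X] topspace_D_topology[OF Y] openin_D_topology
proof (intro conjI allI impI)
  show "f ` points X \<subseteq> points Y"
    using f by (auto simp: smooth_def)
  fix A assume A: "D_open Y A"
  show "D_open X {x \<in> points X. f x \<in> A}"
    unfolding D_open_def
  proof (intro conjI ballI, blast, clarify)
    fix n U P assume P: "(n, U, P) \<in> plots X"
    then have "(n, U, restrict (f \<circ> P) U) \<in> plots Y"
      using f unfolding smooth_def by blast
    then have "openin (Euclidean_space n) {r \<in> U. restrict (f \<circ> P) U r \<in> A}"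
      by (rule D_open_preimage[OF A])
    moreover have "{r \<in> U. restrict (f \<circ> P) U r \<in> A} = {r \<in> U. P r \<in> {x \<in> points X. f x \<in> A}}"
      using plotD(2)[OF X P] by auto
    ultimately show "openin (Euclidean_space n) {r \<in> U. P r \<in> {x \<in> points X. f x \<in> A}}"
      by simp
  qed
qed

section \<open>Domains and pullbacks over domains\<close>

lemma plots_domain_diff:
  "(m, V, F) \<in> plots (domain_diff n U) \<longleftrightarrow>
     openin (Euclidean_space m) V \<and> F \<in> V \<rightarrow>\<^sub>E U \<and> smooth_map m V n U F"
  by (auto simp: domain_diff_def parametrizations_def)

text \<open>The identity of \<open>U\<close> is a plot, so D-open sets are open. The converse is the
  continuity of smooth maps.\<close>

lemma D_open_domain_diff:
  assumes U: "openin (Euclidean_space n) U"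
  shows "D_open (domain_diff n U) A \<longleftrightarrow> openin (Euclidean_space n) A \<and> A \<subseteq> U"
proof
  assume A: "D_open (domain_diff n U) A"
  then have "A \<subseteq> U"
    by (simp add: D_open_def domain_diff_def)
  have "(n, U, restrict (\<lambda>x. x) U) \<in> plots (domain_diff n U)"
    using U by (auto simp: plots_domain_diff smooth_map_restrict_iff smooth_map_inclusion)
  from D_open_preimage[OF A this] have "openin (Euclidean_space n) {r \<in> U. restrict (\<lambda>x. x) U r \<in> A}" .
  moreover have "{r \<in> U. restrict (\<lambda>x. x) U r \<in> A} = A"
    using \<open>A \<subseteq> U\<close> by auto
  ultimately show "openin (Euclidean_space n) A \<and> A \<subseteq> U"
    using \<open>A \<subseteq> U\<close> by simp
next
  assume "openin (Euclidean_space n) A \<and> A \<subseteq> U"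
  then show "D_open (domain_diff n U) A"
    using smooth_map_openin_preimage[OF _ U]
    by (simp add: D_open_def plots_domain_diff split_paired_all) (simp add: domain_diff_def)
qed

lemma points_pullback_domain:
  "points (pullback (domain_diff n U) P E \<pi>) = {(r, x). r \<in> U \<and> x \<in> points E \<and> P r = \<pi> x}"
  by (auto simp: pullback_def subspace_diff_def prod_diff_def domain_diff_def)

text \<open>Openness of \<open>V\<close> and the location of the values are absent on the right
  because the plot of \<open>E\<close> and the smooth first component supply them.\<close>

lemma plots_pullback_domain:
  assumes E: "diffeological_space E"
  shows "(m, V, Q) \<in> plots (pullback (domain_diff n U) P E \<pi>) \<longleftrightarrow>
    Q \<in> extensional V \<and> smooth_map m V n U (\<lambda>v. fst (Q v)) \<and>
    (m, V, restrict (snd \<circ> Q) V) \<in> plots E \<and> (\<forall>v\<in>V. P (fst (Q v)) = \<pi> (snd (Q v)))"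
    (is "?L \<longleftrightarrow> ?R")
proof
  assume L: ?L
  then have V: "openin (Euclidean_space m) V"
    by (auto simp: pullback_def subspace_diff_def prod_diff_def parametrizations_def)
  have "smooth_map m V n U (restrict (fst \<circ> Q) V)"
    using L by (auto simp: pullback_def subspace_diff_def prod_diff_def plots_domain_diff)
  then have "smooth_map m V n U (\<lambda>v. fst (Q v))"
    by (simp add: smooth_map_restrict_iff[OF V] comp_def)
  moreover have "Q \<in> extensional V"
    using L by (simp add: pullback_def subspace_diff_def prod_diff_def parametrizations_def PiE_def)
  ultimately show ?R
    using L by (auto simp: pullback_def subspace_diff_def prod_diff_def)
next
  assume R: ?R
  then have sQ: "(m, V, restrict (snd \<circ> Q) V) \<in> plots E" and F: "smooth_map m V n U (\<lambda>v. fst (Q v))"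
    by simp_all
  have V: "openin (Euclidean_space m) V"
    using plotD(1)[OF E sQ] .
  have FU: "fst (Q v) \<in> U" "snd (Q v) \<in> points E" if "v \<in> V" for v
    using smooth_map_mem[OF F that] PiE_mem[OF plotD(2)[OF E sQ] that] that by simp_all
  have "(m, V, restrict (fst \<circ> Q) V) \<in> plots (domain_diff n U)"
    using R V FU by (auto simp: plots_domain_diff smooth_map_restrict_iff comp_def)
  moreover have "Q \<in> V \<rightarrow>\<^sub>E U \<times> points E"
    using R FU by (auto simp: PiE_def mem_Times_iff)
  moreover have "points (domain_diff n U) = U"
    by (simp add: domain_diff_def)
  moreover have "Q ` V \<subseteq> {(z, x). z \<in> U \<and> x \<in> points E \<and> P z = \<pi> x}"
    using R FU by (auto simp: case_prod_unfold)
  ultimately show ?L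
    using V sQ by (simp add: pullback_def subspace_diff_def prod_diff_def parametrizations_def)
qed

lemma pullback_plotI:
  assumes E: "diffeological_space E" and F: "smooth_map m V n U F" and Q: "(m, V, Q) \<in> plots E"
    and eq: "\<And>v. v \<in> V \<Longrightarrow> P (F v) = \<pi> (Q v)"
  shows "(m, V, restrict (\<lambda>v. (F v, Q v)) V) \<in> plots (pullback (domain_diff n U) P E \<pi>)"
proof -
  have V: "openin (Euclidean_space m) V" and QV: "Q \<in> V \<rightarrow>\<^sub>E points E"
    using plotD[OF E Q] by auto
  have "smooth_map m V n U (\<lambda>v. fst (restrict (\<lambda>v. (F v, Q v)) V v))"
    by (rule smooth_map_cong[OF V _ F]) simp
  moreover have "restrict (snd \<circ> restrict (\<lambda>v. (F v, Q v)) V) V = Q"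
    using QV by (auto simp: fun_eq_iff PiE_def extensional_def restrict_def)
  ultimately show ?thesis
    unfolding plots_pullback_domain[OF E] using Q eq by simp
qed


section \<open>Local lifting of plots\<close>

text \<open>The inverse of the local diffeomorphism given by the pullback is the graph of \<open>L\<close>; that
  the graph is D-open expresses the local uniqueness of lifts.\<close>

lemma etale_pullback_lift:
  assumes E: "diffeological_space E" and U: "openin (Euclidean_space n) U"
    and et: "etale_map (pullback (domain_diff n U) P E \<pi>) (domain_diff n U) fst"
    and r0: "r0 \<in> U" "e \<in> points E" "P r0 = \<pi> e"
  obtains T L where "openin (Euclidean_space n) T" and "r0 \<in> T" and "T \<subseteq> U"
    and "(n, T, L) \<in> plots E" and "\<And>r. r \<in> T \<Longrightarrow> \<pi> (L r) = P r" and "L r0 = e"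
    and "D_open (pullback (domain_diff n U) P E \<pi>) {(r, x). r \<in> T \<and> x = L r}"
proof -
  let ?G = "pullback (domain_diff n U) P E \<pi>"
  have "(r0, e) \<in> points ?G"
    using r0 by (simp add: points_pullback_domain)
  then obtain S T where S: "D_open ?G S" "(r0, e) \<in> S" and T: "D_open (domain_diff n U) T"
    and dif: "diffeomorphism (subspace_diff ?G S) (subspace_diff (domain_diff n U) T) fst"
    using et unfolding etale_map_def openin_D_topology by metis
  have TU: "openin (Euclidean_space n) T" "T \<subseteq> U"
    using T D_open_domain_diff[OF U] by auto
  have SG: "S \<subseteq> points ?G"
    using S(1) by (simp add: D_open_def)
  then have points: "points (subspace_diff ?G S) = S"
    "points (subspace_diff (domain_diff n U) T) = T"
    using TU(2) by (auto simp: subspace_diff_def domain_diff_def)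
  then have bij: "bij_betw fst S T"
    using dif by (simp add: diffeomorphism_def)
  define \<sigma> where "\<sigma> = inv_into S fst"
  have \<sigma>: "\<sigma> r \<in> S" "fst (\<sigma> r) = r" if "r \<in> T" for r
    using bij that by (auto simp: \<sigma>_def bij_betw_def inv_into_into f_inv_into_f)
  have \<sigma>_fst: "\<sigma> (fst s) = s" if "s \<in> S" for s
    using bij that by (simp add: \<sigma>_def bij_betw_def)
  \<comment> \<open>Applied to the identity plot of \<open>T\<close>, smoothness of the inverse says
    that \<open>\<sigma>\<close> is itself a plot of the pullback. Its second component is the
    lift.\<close>
  have "(n, T, restrict (\<lambda>x. x) T) \<in> plots (subspace_diff (domain_diff n U) T)"
    using TU by (auto simp: subspace_diff_def plots_domain_diff smooth_map_restrict_iff smooth_map_inclusion)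
  then have "(n, T, restrict (\<sigma> \<circ> restrict (\<lambda>x. x) T) T) \<in> plots (subspace_diff ?G S)"
    using dif unfolding diffeomorphism_def smooth_def points \<sigma>_def by blast
  then have "(n, T, restrict \<sigma> T) \<in> plots ?G"
    by (simp add: subspace_diff_def comp_def cong: restrict_cong)
  then have "(n, T, restrict (snd \<circ> restrict \<sigma> T) T) \<in> plots E"
    unfolding plots_pullback_domain[OF E] by blast
  moreover define L where "L = restrict (\<lambda>r. snd (\<sigma> r)) T"
  moreover have "restrict (snd \<circ> restrict \<sigma> T) T = L"
    by (auto simp: L_def)
  ultimately have "(n, T, L) \<in> plots E"
    by simp
  moreover have L: "(r, L r) \<in> S" if "r \<in> T" for r
    using \<sigma>[OF that] that by (metis L_def prod.collapse restrict_apply')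
  then have "\<pi> (L r) = P r" if "r \<in> T" for r
    using subsetD[OF SG L[OF that]] by (simp add: points_pullback_domain)
  \<comment> \<open>Since \<open>fst\<close> is injective on \<open>S\<close>, only one point of
    \<open>S\<close> lies over each \<open>r\<close> in \<open>T\<close>; thus the D-open set
    \<open>S\<close> is the graph itself.\<close>
  moreover have graph: "S = {(r, x). r \<in> T \<and> x = L r}"
  proof -
    have "r \<in> T \<and> x = L r" if "(r, x) \<in> S" for r x
      using \<sigma>_fst[OF that] bij_betwE[OF bij, rule_format, OF that] by (auto simp: L_def)
    then show ?thesis
      using L by auto
  qed
  moreover have "r0 \<in> T" "L r0 = e"
    using S(2) graph by auto
  ultimately show thesis
    using TU S(1) by (intro that[of T L]) simp_all
qed

text \<open>The pair of \<open>F\<close> and \<open>Q\<close> is a plot of the pullback, and the set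
  in question is its preimage of the graph. Openness of this set is local uniqueness: if
  \<open>Q\<close> agrees with \<open>L \<circ> F\<close> at a point, it does so nearby.\<close>

lemma lift_unique:
  assumes E: "diffeological_space E"
    and graph: "D_open (pullback (domain_diff n U) P E \<pi>) {(r, x). r \<in> T \<and> x = L r}"
    and Q: "(m, V, Q) \<in> plots E" and F: "smooth_map m V n U F"
    and eq: "\<And>v. v \<in> V \<Longrightarrow> \<pi> (Q v) = P (F v)"
  shows "openin (Euclidean_space m) {v \<in> V. F v \<in> T \<and> Q v = L (F v)}"
proof -
  have "(m, V, restrict (\<lambda>v. (F v, Q v)) V) \<in> plots (pullback (domain_diff n U) P E \<pi>)"
    using eq by (intro pullback_plotI[OF E F Q]) simp
  from D_open_preimage[OF graph this]
  have "openin (Euclidean_space m) {v \<in> V. restrict (\<lambda>v. (F v, Q v)) V v \<in> {(r, x). r \<in> T \<and> x = L r}}" .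
  moreover have "{v \<in> V. restrict (\<lambda>v. (F v, Q v)) V v \<in> {(r, x). r \<in> T \<and> x = L r}} =
      {v \<in> V. F v \<in> T \<and> Q v = L (F v)}"
    by (rule Collect_cong) auto
  ultimately show ?thesis
    by simp
qed

lemma diffeological_etale_lift:
  assumes "diffeological_space E" and X: "diffeological_space X" and "diffeological_etale_map E X \<pi>"
    and P: "(n, U, P) \<in> plots X" and "r0 \<in> U" "e \<in> points E" "P r0 = \<pi> e"
  obtains T L where "openin (Euclidean_space n) T" and "r0 \<in> T" and "T \<subseteq> U"
    and "(n, T, L) \<in> plots E" and "\<And>r. r \<in> T \<Longrightarrow> \<pi> (L r) = P r" and "L r0 = e"
    and "D_open (pullback (domain_diff n U) P E \<pi>) {(r, x). r \<in> T \<and> x = L r}"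
proof -
  have "etale_map (pullback (domain_diff n U) P E \<pi>) (domain_diff n U) fst"
    using assms(3) P unfolding diffeological_etale_map_def by blast
  then show thesis
    by (rule etale_pullback_lift[OF assms(1) plotD(1)[OF X P], where P = P and \<pi> = \<pi> and ?r0.0 = r0 and e = e])
      (use assms(5-7) that in auto)
qed

section \<open>Manifolds as diffeological spaces\<close>

lemma smooth_atlasD:
  assumes "smooth_atlas M \<A>" and "(n, D, \<phi>) \<in> \<A>"
  shows "D \<subseteq> M" and "inj_on \<phi> D" and "openin (Euclidean_space n) (\<phi> ` D)"
  using assms by (fastforce simp: smooth_atlas_def)+

lemma smooth_atlas_transition:
  assumes "smooth_atlas M \<A>" and "(n, D, \<phi>) \<in> \<A>" and "(m, D', \<psi>) \<in> \<A>"
  shows "openin (Euclidean_space n) (\<phi> ` (D \<inter> D'))"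
    and "smooth_map n (\<phi> ` (D \<inter> D')) m (\<psi> ` (D \<inter> D')) (\<psi> \<circ> inv_into D \<phi>)"
proof -
  have "\<forall>(n, D, \<phi>)\<in>\<A>. \<forall>(m, D', \<psi>)\<in>\<A>. openin (Euclidean_space n) (\<phi> ` (D \<inter> D')) \<and>
        smooth_map n (\<phi> ` (D \<inter> D')) m (\<psi> ` (D \<inter> D')) (\<psi> \<circ> inv_into D \<phi>)"
    using assms(1) unfolding smooth_atlas_def by (elim conjE)
  from bspec[OF this assms(2)] have "\<forall>(m, D', \<psi>)\<in>\<A>. openin (Euclidean_space n) (\<phi> ` (D \<inter> D')) \<and>
        smooth_map n (\<phi> ` (D \<inter> D')) m (\<psi> ` (D \<inter> D')) (\<psi> \<circ> inv_into D \<phi>)"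
    by simp
  from bspec[OF this assms(3)]
  show "openin (Euclidean_space n) (\<phi> ` (D \<inter> D'))"
    and "smooth_map n (\<phi> ` (D \<inter> D')) m (\<psi> ` (D \<inter> D')) (\<psi> \<circ> inv_into D \<phi>)"
    by simp_all
qed

lemma manifold_plotI:
  assumes "openin (Euclidean_space m) U" and "P \<in> U \<rightarrow>\<^sub>E M"
    and "\<And>n D \<phi>. (n, D, \<phi>) \<in> \<A> \<Longrightarrow> openin (Euclidean_space m) {r \<in> U. P r \<in> D}"
    and "\<And>n D \<phi>. (n, D, \<phi>) \<in> \<A> \<Longrightarrow> smooth_map m {r \<in> U. P r \<in> D} n (\<phi> ` D) (\<phi> \<circ> P)"
  shows "(m, U, P) \<in> plots (manifold_diff M \<A>)"
  using assms by (auto simp: manifold_diff_def parametrizations_def)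

lemma manifold_plotD:
  assumes "(m, U, P) \<in> plots (manifold_diff M \<A>)"
  shows "openin (Euclidean_space m) U" and "P \<in> U \<rightarrow>\<^sub>E M"
    and "(n, D, \<phi>) \<in> \<A> \<Longrightarrow> openin (Euclidean_space m) {r \<in> U. P r \<in> D}"
    and "(n, D, \<phi>) \<in> \<A> \<Longrightarrow> smooth_map m {r \<in> U. P r \<in> D} n (\<phi> ` D) (\<phi> \<circ> P)"
  using assms by (auto simp: manifold_diff_def parametrizations_def)

lemma points_manifold_diff [simp]: "points (manifold_diff M \<A>) = M"
  by (simp add: manifold_diff_def)

text \<open>Read in another chart, the inverse of a chart is a transition map, so the claim is the
  compatibility of the atlas. These plots also show that the plots cover the manifold.\<close>

lemma chart_inverse_plot:
  assumes \<A>: "smooth_atlas M \<A>" and ch: "(n, D, \<phi>) \<in> \<A>"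
  shows "(n, \<phi> ` D, restrict (inv_into D \<phi>) (\<phi> ` D)) \<in> plots (manifold_diff M \<A>)" (is "(n, ?U, ?P) \<in> _")
proof (rule manifold_plotI)
  note D = smooth_atlasD[OF \<A> ch]
  show "openin (Euclidean_space n) ?U"
    using D by blast
  have inv: "inv_into D \<phi> (\<phi> d) = d" if "d \<in> D" for d
    using D(2) that by simp
  then show "?P \<in> ?U \<rightarrow>\<^sub>E M"
    using D(1) by auto
  fix m D' \<psi> assume ch': "(m, D', \<psi>) \<in> \<A>"
  have eq: "{r \<in> ?U. ?P r \<in> D'} = \<phi> ` (D \<inter> D')"
  proof (intro equalityI subsetI)
    fix r assume "r \<in> {r \<in> ?U. ?P r \<in> D'}"
    then obtain d where "d \<in> D" "r = \<phi> d" "?P r \<in> D'"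
      by blast
    then show "r \<in> \<phi> ` (D \<inter> D')"
      using inv by simp
  next
    fix r assume "r \<in> \<phi> ` (D \<inter> D')"
    then obtain d where "d \<in> D" "d \<in> D'" "r = \<phi> d"
      by blast
    then show "r \<in> {r \<in> ?U. ?P r \<in> D'}"
      using inv by simp
  qed
  note tr = smooth_atlas_transition[OF \<A> ch ch']
  show "openin (Euclidean_space n) {r \<in> ?U. ?P r \<in> D'}"
    unfolding eq by (rule tr(1))
  have "smooth_map n (\<phi> ` (D \<inter> D')) m (\<psi> ` D') (\<psi> \<circ> inv_into D \<phi>)"
    by (rule smooth_map_subset[OF tr(2) order_refl]) (use inv in auto)
  then show "smooth_map n {r \<in> ?U. ?P r \<in> D'} m (\<psi> ` D') (\<psi> \<circ> ?P)"
    unfolding eq by (rule smooth_map_cong[OF tr(1), rotated]) auto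
qed

text \<open>In a chart the composite is \<open>\<phi> \<circ> P\<close> after \<open>F\<close>, on
  the preimage of the chart domain. That preimage is open because smooth maps are continuous, and
  the chain rule applies on it.\<close>

lemma manifold_plot_compose:
  assumes \<A>: "smooth_atlas M \<A>" and P: "(n, U, P) \<in> plots (manifold_diff M \<A>)"
    and V: "openin (Euclidean_space m) V" and F: "smooth_map m V n U F"
  shows "(m, V, restrict (P \<circ> F) V) \<in> plots (manifold_diff M \<A>)" (is "(m, V, ?Q) \<in> _")
proof (rule manifold_plotI[OF V])
  note P' = manifold_plotD[OF P]
  have FU: "F v \<in> U" if "v \<in> V" for v
    using smooth_map_mem[OF F that] .
  show "?Q \<in> V \<rightarrow>\<^sub>E M"
    using FU PiE_mem[OF P'(2)] by simp
  fix k D \<phi> assume ch: "(k, D, \<phi>) \<in> \<A>"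
  let ?W = "{r \<in> U. P r \<in> D}"
  let ?V = "{v \<in> V. F v \<in> ?W}"
  have W: "openin (Euclidean_space n) ?W"
    by (rule P'(3)[OF ch])
  have V': "openin (Euclidean_space m) ?V"
    by (rule smooth_map_openin_preimage[OF V P'(1) F W])
  have eq: "{v \<in> V. ?Q v \<in> D} = ?V"
    using FU by auto
  show "openin (Euclidean_space m) {v \<in> V. ?Q v \<in> D}"
    unfolding eq by (rule V')
  have "smooth_map m ?V n ?W F"
    by (rule smooth_map_subset[OF F]) auto
  from smooth_map_compose[OF V' W this P'(4)[OF ch]]
  show "smooth_map m {v \<in> V. ?Q v \<in> D} k (\<phi> ` D) (\<phi> \<circ> ?Q)"
    unfolding eq by (rule smooth_map_cong[OF V', rotated]) simp
qed

text \<open>Both chart conditions can be tested near each point: the part of \<open>V\<close> that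
  \<open>P\<close> sends into the chart domain is one neighbourhood serving for openness and for
  smoothness. This yields the gluing axiom.\<close>

lemma manifold_plot_local:
  assumes P: "P \<in> extensional U"
    and loc: "\<And>r. r \<in> U \<Longrightarrow> \<exists>V. r \<in> V \<and> V \<subseteq> U \<and> (m, V, restrict P V) \<in> plots (manifold_diff M \<A>)"
  shows "(m, U, P) \<in> plots (manifold_diff M \<A>)"
proof (rule manifold_plotI)
  have nbhd: "\<exists>V. openin (Euclidean_space m) V \<and> r \<in> V \<and> V \<subseteq> U \<and> P r \<in> M" if r: "r \<in> U" for r
  proof -
    obtain V where V: "r \<in> V" "V \<subseteq> U" "(m, V, restrict P V) \<in> plots (manifold_diff M \<A>)"
      using loc[OF r] by blast
    have "P r \<in> M"
      using PiE_mem[OF manifold_plotD(2)[OF V(3)] V(1)] V(1) by simp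
    then show ?thesis
      using V manifold_plotD(1)[OF V(3)] by blast
  qed
  then show "openin (Euclidean_space m) U"
    by (subst openin_subopen) meson
  show "P \<in> U \<rightarrow>\<^sub>E M"
    using nbhd P by (auto simp: PiE_def)
  fix n D \<phi> assume ch: "(n, D, \<phi>) \<in> \<A>"
  have ex: "\<exists>W. openin (Euclidean_space m) W \<and> r \<in> W \<and> W \<subseteq> {r \<in> U. P r \<in> D} \<and>
      smooth_map m W n (\<phi> ` D) (\<phi> \<circ> P)"
    if "r \<in> {r \<in> U. P r \<in> D}" for r
  proof -
    have r: "r \<in> U" "P r \<in> D"
      using that by auto
    obtain V where V: "r \<in> V" "V \<subseteq> U" "(m, V, restrict P V) \<in> plots (manifold_diff M \<A>)"
      using loc[OF r(1)] by blast
    let ?W = "{r \<in> V. restrict P V r \<in> D}"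
    have W: "openin (Euclidean_space m) ?W"
      using manifold_plotD(3)[OF V(3) ch] .
    have "smooth_map m ?W n (\<phi> ` D) (\<phi> \<circ> P)"
      by (rule smooth_map_cong[OF W _ manifold_plotD(4)[OF V(3) ch]]) simp
    then show ?thesis
      using W V r by (intro exI[of _ ?W]) auto
  qed
  show op: "openin (Euclidean_space m) {r \<in> U. P r \<in> D}"
  proof (subst openin_subopen, intro ballI)
    fix r assume "r \<in> {r \<in> U. P r \<in> D}"
    from ex[OF this] show "\<exists>T. openin (Euclidean_space m) T \<and> r \<in> T \<and> T \<subseteq> {r \<in> U. P r \<in> D}"
      by (elim exE conjE) (intro exI conjI)
  qed
  show "smooth_map m {r \<in> U. P r \<in> D} n (\<phi> ` D) (\<phi> \<circ> P)"
    by (rule smooth_map_local[OF op]) (rule ex)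
qed

lemma diffeological_space_manifold_diff:
  assumes \<A>: "smooth_atlas M \<A>"
  shows "diffeological_space (manifold_diff M \<A>)"
  unfolding diffeological_space_def
proof (intro conjI)
  show par: "plots (manifold_diff M \<A>) \<subseteq> parametrizations (points (manifold_diff M \<A>))"
    by (auto simp: manifold_diff_def)
  show "(\<Union>(n, U, P)\<in>plots (manifold_diff M \<A>). P ` U) = points (manifold_diff M \<A>)"
  proof (intro equalityI subsetI)
    fix x assume "x \<in> points (manifold_diff M \<A>)"
    then have "x \<in> (\<Union>(n, D, \<phi>)\<in>\<A>. D)"
      using \<A> unfolding smooth_atlas_def points_manifold_diff by blast
    then obtain n D \<phi> where ch: "(n, D, \<phi>) \<in> \<A>" and x: "x \<in> D"
      by auto
    have "restrict (inv_into D \<phi>) (\<phi> ` D) (\<phi> x) = x"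
      using x smooth_atlasD(2)[OF \<A> ch] by simp
    then have "x \<in> restrict (inv_into D \<phi>) (\<phi> ` D) ` (\<phi> ` D)"
      using x by (metis image_eqI)
    then show "x \<in> (\<Union>(n, U, P)\<in>plots (manifold_diff M \<A>). P ` U)"
      by (intro UN_I[OF chart_inverse_plot[OF \<A> ch]]) simp
  next
    fix x assume "x \<in> (\<Union>(n, U, P)\<in>plots (manifold_diff M \<A>). P ` U)"
    then obtain n U P r where "(n, U, P) \<in> plots (manifold_diff M \<A>)" "r \<in> U" "x = P r"
      by auto
    then show "x \<in> points (manifold_diff M \<A>)"
      using PiE_mem[OF manifold_plotD(2)] by auto
  qed
  show "\<forall>(n, U, P)\<in>plots (manifold_diff M \<A>). \<forall>m V F.
        openin (Euclidean_space m) V \<and> smooth_map m V n U F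
          \<longrightarrow> (m, V, restrict (P \<circ> F) V) \<in> plots (manifold_diff M \<A>)"
    using manifold_plot_compose[OF \<A>] by (simp add: split_paired_all)
  show "\<forall>n S P. (\<forall>(U, Q)\<in>S. (n, U, Q) \<in> plots (manifold_diff M \<A>)) \<and>
        (\<forall>(U, Q)\<in>S. \<forall>(V, R)\<in>S. \<forall>r\<in>U \<inter> V. Q r = R r) \<and>
        P \<in> extensional (\<Union>(U, Q)\<in>S. U) \<and> (\<forall>(U, Q)\<in>S. \<forall>r\<in>U. P r = Q r)
          \<longrightarrow> (n, (\<Union>(U, Q)\<in>S. U), P) \<in> plots (manifold_diff M \<A>)"
  proof (intro allI impI, elim conjE)
    fix n S and P :: "rvec \<Rightarrow> 'a"
    assume S: "\<forall>(U, Q)\<in>S. (n, U, Q) \<in> plots (manifold_diff M \<A>)"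
      and P: "P \<in> extensional (\<Union>(U, Q)\<in>S. U)" "\<forall>(U, Q)\<in>S. \<forall>r\<in>U. P r = Q r"
    show "(n, (\<Union>(U, Q)\<in>S. U), P) \<in> plots (manifold_diff M \<A>)"
    proof (rule manifold_plot_local[OF P(1)])
      fix r assume "r \<in> (\<Union>(U, Q)\<in>S. U)"
      then obtain U Q where U: "(U, Q) \<in> S" "r \<in> U"
        by auto
      have Q: "(n, U, Q) \<in> plots (manifold_diff M \<A>)" and PQ: "\<forall>r\<in>U. P r = Q r"
        using bspec[OF S U(1)] bspec[OF P(2) U(1)] by simp_all
      have "restrict P U = Q"
        using manifold_plotD(2)[OF Q] PQ by (auto simp: fun_eq_iff PiE_def extensional_def)
      moreover have "U \<subseteq> (\<Union>(U, Q)\<in>S. U)"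
        using UN_upper[OF U(1), of "\<lambda>(U, Q). U"] by simp
      ultimately show "\<exists>V. r \<in> V \<and> V \<subseteq> (\<Union>(U, Q)\<in>S. U) \<and> (n, V, restrict P V) \<in> plots (manifold_diff M \<A>)"
        using U(2) Q by (intro exI[of _ U]) simp
    qed
  qed
qed

section \<open>Properties of diffeological etale maps\<close>

lemma diffeological_etale_imp_smooth: "diffeological_etale_map E X \<pi> \<Longrightarrow> smooth E X \<pi>"
  by (simp add: diffeological_etale_map_def)

lemma smooth_plot:
  "smooth X Y f \<Longrightarrow> (n, U, P) \<in> plots X \<Longrightarrow> (n, U, restrict (f \<circ> P) U) \<in> plots Y"
  by (auto simp: smooth_def)

text \<open>If \<open>P r = \<pi> e\<close> with \<open>e\<close> in \<open>A\<close>, the lift of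
  \<open>P\<close> through \<open>e\<close> is a plot of \<open>E\<close>. It stays in the D-open
  set \<open>A\<close> near \<open>r\<close>, and there \<open>P\<close> has its values in the image
  of \<open>A\<close>.\<close>

lemma diffeological_etale_imp_open_map:
  assumes E: "diffeological_space E" and X: "diffeological_space X" and et: "diffeological_etale_map E X \<pi>"
  shows "open_map (D_topology E) (D_topology X) \<pi>"
  unfolding open_map_def openin_D_topology
proof (intro allI impI)
  fix A assume A: "D_open E A"
  then have AE: "A \<subseteq> points E"
    by (simp add: D_open_def)
  have \<pi>: "\<pi> \<in> points E \<rightarrow> points X"
    using diffeological_etale_imp_smooth[OF et] by (simp add: smooth_def)
  have "openin (Euclidean_space n) {r \<in> U. P r \<in> \<pi> ` A}" if P: "(n, U, P) \<in> plots X" for n U P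
  proof (subst openin_subopen, clarify)
    fix r e assume r: "r \<in> U" "P r = \<pi> e" "e \<in> A"
    then obtain T L where T: "openin (Euclidean_space n) T" "r \<in> T" "T \<subseteq> U" "(n, T, L) \<in> plots E"
      "\<And>r. r \<in> T \<Longrightarrow> \<pi> (L r) = P r" "L r = e"
      by (rule_tac diffeological_etale_lift[OF E X et P r(1), of e]) (use AE in auto)
    show "\<exists>W. openin (Euclidean_space n) W \<and> r \<in> W \<and> W \<subseteq> {r \<in> U. P r \<in> \<pi> ` A}"
    proof (intro exI conjI)
      show "openin (Euclidean_space n) {r \<in> T. L r \<in> A}"
        using D_open_preimage[OF A T(4)] .
      show "r \<in> {r \<in> T. L r \<in> A}"
        using T r by simp
      show "{r \<in> T. L r \<in> A} \<subseteq> {r \<in> U. P r \<in> \<pi> ` A}"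
        using T(3,5) by (auto simp flip: T(5))
    qed
  qed
  then show "D_open X (\<pi> ` A)"
    using AE \<pi> unfolding D_open_def by fastforce
qed

text \<open>A plot in a stalk and the constant map lift the same constant plot of the base.\<close>

lemma diffeological_etale_discrete_stalk:
  assumes E: "diffeological_space E" and X: "diffeological_space X" and et: "diffeological_etale_map E X \<pi>"
  shows "discrete_diff (subspace_diff E {e \<in> points E. \<pi> e = x})" (is "discrete_diff ?S")
proof -
  have "(n, U, P) \<in> plots ?S \<longleftrightarrow> (n, U, P) \<in> parametrizations (points ?S) \<and>
       (\<forall>r\<in>U. \<exists>V. openin (Euclidean_space n) V \<and> r \<in> V \<and> V \<subseteq> U \<and> (\<forall>s\<in>V. P s = P r))"
    (is "?L \<longleftrightarrow> ?R") for n U P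
  proof
    assume L: ?L
    then have P: "(n, U, P) \<in> plots E" and Px: "\<And>r. r \<in> U \<Longrightarrow> \<pi> (P r) = x"
      by (auto simp: subspace_diff_def)
    have U: "openin (Euclidean_space n) U" and PU: "P \<in> U \<rightarrow>\<^sub>E points E"
      using plotD[OF E P] by auto
    have "\<exists>V. openin (Euclidean_space n) V \<and> r \<in> V \<and> V \<subseteq> U \<and> (\<forall>s\<in>V. P s = P r)" if r: "r \<in> U" for r
    proof -
      let ?\<pi>P = "restrict (\<pi> \<circ> P) U"
      have "(n, U, ?\<pi>P) \<in> plots X"
        using smooth_plot[OF diffeological_etale_imp_smooth[OF et] P] .
      then obtain T L where T: "r \<in> T" "L r = P r"
        "D_open (pullback (domain_diff n U) ?\<pi>P E \<pi>) {(r, x). r \<in> T \<and> x = L r}"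
        by (rule diffeological_etale_lift[OF E X et _ r, where e = "P r"]) (use r PU in auto)
      \<comment> \<open>Here \<open>F\<close> is the constant map with value \<open>r\<close>, so
        \<open>L \<circ> F\<close> is constant with value \<open>L r = P r\<close>. The equation for
        \<open>lift_unique\<close> holds because \<open>\<pi> \<circ> P\<close> is constant.\<close>
      have "openin (Euclidean_space n) {v \<in> U. r \<in> T \<and> P v = L r}"
        by (rule lift_unique[OF E T(3) P smooth_map_const[OF r]]) (use Px r in simp)
      then show ?thesis
        using T(1,2) r by (intro exI[of _ "{v \<in> U. r \<in> T \<and> P v = L r}"]) auto
    qed
    moreover have "(n, U, P) \<in> parametrizations (points ?S)"
      using U PU Px by (auto simp: parametrizations_def subspace_diff_def)
    ultimately show ?R
      by blast
  next
    \<comment> \<open>Locally constant parametrizations are plots of any diffeological space, by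
      gluing constant plots.\<close>
    assume R: ?R
    then have PU: "P \<in> U \<rightarrow>\<^sub>E {e \<in> points E. \<pi> e = x}"
      by (auto simp: parametrizations_def subspace_diff_def)
    have "(n, U, P) \<in> plots E"
    proof (rule plot_local[OF E])
      show "P \<in> extensional U"
        using PU by (simp add: PiE_def)
      fix r assume r: "r \<in> U"
      then have "\<exists>V. openin (Euclidean_space n) V \<and> r \<in> V \<and> V \<subseteq> U \<and> (\<forall>s\<in>V. P s = P r)"
        using R by simp
      then obtain V where V: "openin (Euclidean_space n) V" "r \<in> V" "V \<subseteq> U" "\<forall>s\<in>V. P s = P r"
        by (elim exE conjE)
      have "P r \<in> points E"
        using PiE_mem[OF PU r] by simp
      then have "(n, V, restrict (\<lambda>_. P r) V) \<in> plots E"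
        using plot_const[OF E _ V(1)] by blast
      moreover have "restrict (\<lambda>_. P r) V = restrict P V"
        using V(4) by (intro restrict_ext) simp
      ultimately show "\<exists>V. r \<in> V \<and> V \<subseteq> U \<and> (n, V, restrict P V) \<in> plots E"
        using V(2,3) by auto
    qed
    then show ?L
      using PU by (auto simp: subspace_diff_def)
  qed
  then show ?thesis
    unfolding discrete_diff_def by auto
qed

text \<open>The map \<open>\<rho>\<close> is the graph map of a lift, defined on the domain
  \<open>T\<close> of the lift. The neighbourhood \<open>S\<close> is the graph, on which
  \<open>\<rho>\<close> inverts the projection.\<close>

lemma diffeological_etale_imp_immersion:
  assumes E: "diffeological_space E" and X: "diffeological_space X" and et: "diffeological_etale_map E X \<pi>"
  shows "diffeological_immersion E X \<pi>"
  unfolding diffeological_immersion_def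
proof (intro conjI diffeological_etale_imp_smooth[OF et] ballI, clarify)
  fix n U P r0 x0
  let ?G = "pullback (domain_diff n U) P E \<pi>"
  assume P: "(n, U, P) \<in> plots X" and "(r0, x0) \<in> points ?G"
  then have r0: "r0 \<in> U" "x0 \<in> points E" "P r0 = \<pi> x0"
    by (auto simp: points_pullback_domain)
  obtain T L where T: "openin (Euclidean_space n) T" "r0 \<in> T" "T \<subseteq> U" "(n, T, L) \<in> plots E" "L r0 = x0"
    "D_open ?G {(r, x). r \<in> T \<and> x = L r}"
    by (rule diffeological_etale_lift[OF E X et P r0]) blast
  have U: "openin (Euclidean_space n) U" and LT: "L \<in> T \<rightarrow>\<^sub>E points E"
    using plotD[OF X P] plotD[OF E T(4)] by auto
  have "smooth (domain_diff n T) (prod_diff (domain_diff n U) E) (\<lambda>r. (r, L r))"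
    unfolding smooth_def
  proof (intro conjI ballI, goal_cases)
    case 1
    then show ?case
      using T(3) LT by (auto simp: domain_diff_def prod_diff_def)
  next
    case (2 p)
    obtain m V F where p: "p = (m, V, F)"
      by (cases p)
    then have V: "openin (Euclidean_space m) V" and FT: "F \<in> V \<rightarrow>\<^sub>E T" and F: "smooth_map m V n T F"
      using 2 by (auto simp: plots_domain_diff)
    let ?Q = "restrict ((\<lambda>r. (r, L r)) \<circ> F) V"
    have "(m, V, restrict (L \<circ> F) V) \<in> plots E"
      by (rule plot_compose[OF E T(4) V F])
    moreover have "restrict (snd \<circ> ?Q) V = restrict (L \<circ> F) V" and fQ: "restrict (fst \<circ> ?Q) V = F"
      using FT by (auto simp: fun_eq_iff PiE_def extensional_def)
    moreover have "(m, V, restrict (fst \<circ> ?Q) V) \<in> plots (domain_diff n U)"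
      unfolding fQ using V FT T(3) smooth_map_subset[OF F order_refl, of U]
      by (auto simp: plots_domain_diff PiE_def)
    moreover have "points (domain_diff n U) = U"
      by (simp add: domain_diff_def)
    moreover have "F v \<in> U" "L (F v) \<in> points E" if "v \<in> V" for v
      using PiE_mem[OF FT that] PiE_mem[OF LT] T(3) by auto
    then have "?Q \<in> V \<rightarrow>\<^sub>E U \<times> points E"
      by simp
    ultimately show ?case
      using V by (simp add: p prod_diff_def parametrizations_def)
  qed
  then show "\<exists>S V \<rho>. openin (D_topology ?G) S \<and> (r0, x0) \<in> S \<and>
          openin (Euclidean_space n) V \<and> fst ` S \<subseteq> V \<and> V \<subseteq> U \<and>
          smooth (domain_diff n V) (prod_diff (domain_diff n U) E) \<rho> \<and>
          (\<forall>(r, x)\<in>S. \<rho> (fst (r, x)) = (r, x))"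
    using T unfolding openin_D_topology
    by (intro exI[of _ "{(r, x). r \<in> T \<and> x = L r}"] exI[of _ T] exI[of _ "\<lambda>r. (r, L r)"]) auto
qed

text \<open>The topological half holds because an injective, continuous and open map is a
  topological embedding.\<close>

lemma injective_diffeological_etale_imp_embedding:
  assumes E: "diffeological_space E" and X: "diffeological_space X" and et: "diffeological_etale_map E X \<pi>"
    and inj: "inj_on \<pi> (points E)"
  shows "diffeological_embedding E X \<pi>"
  unfolding diffeological_embedding_def
  using diffeological_etale_imp_immersion[OF E X et]
    smooth_imp_continuous_map[OF E X diffeological_etale_imp_smooth[OF et]]
    diffeological_etale_imp_open_map[OF E X et] inj
  by (simp add: injective_open_imp_embedding_map topspace_D_topology[OF E])

section \<open>Etale maps compared with diffeological etale maps\<close>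

text \<open>An etale map is given as smooth only on D-open pieces. The preimages of these pieces
  under a plot are open and cover its domain, so the composites glue.\<close>

lemma etale_map_imp_smooth:
  assumes X: "diffeological_space X" and Y: "diffeological_space Y" and et: "etale_map X Y f"
  shows "smooth X Y f"
  unfolding smooth_def
proof (intro conjI ballI, goal_cases)
  case 1
  then show ?case
    using et by (simp add: etale_map_def)
next
  case (2 p)
  obtain n U P where p: "p = (n, U, P)"
    by (cases p)
  then have P: "(n, U, P) \<in> plots X"
    using 2 by simp
  have "(n, U, restrict (f \<circ> P) U) \<in> plots Y"
  proof (rule plot_local[OF Y])
    fix r assume r: "r \<in> U"
    then have "P r \<in> points X"
      using PiE_mem[OF plotD(2)[OF X P]] by simp
    then obtain S T where S: "D_open X S" "P r \<in> S"
      and f: "diffeomorphism (subspace_diff X S) (subspace_diff Y T) f"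
      using et unfolding etale_map_def openin_D_topology by metis
    let ?V = "{r \<in> U. P r \<in> S}"
    have sm: "smooth (subspace_diff X S) (subspace_diff Y T) f"
      using f by (simp add: diffeomorphism_def)
    have "(n, ?V, restrict (f \<circ> restrict P ?V) ?V) \<in> plots Y"
      using smooth_plot[OF sm plot_into_D_open[OF X S(1) P]] by (simp add: subspace_diff_def)
    moreover have "restrict (f \<circ> restrict P ?V) ?V = restrict (restrict (f \<circ> P) U) ?V"
      by auto
    ultimately show "\<exists>V. r \<in> V \<and> V \<subseteq> U \<and> (n, V, restrict (restrict (f \<circ> P) U) V) \<in> plots Y"
      using r S(2) by (intro exI[of _ ?V]) auto
  qed simp
  then show ?case
    by (simp add: p)
qed

text \<open>A local inverse \<open>\<tau>\<close> of \<open>f\<close> pulls back to a local inverse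
  of the projection, namely \<open>r \<mapsto> (r, \<tau> (P r))\<close> on the preimage of
  \<open>T\<close> under \<open>P\<close>.\<close>

lemma etale_map_imp_diffeological_etale:
  assumes X: "diffeological_space X" and Y: "diffeological_space Y" and et: "etale_map X Y f"
  shows "diffeological_etale_map X Y f"
proof -
  have "etale_map (pullback (domain_diff n U) P X f) (domain_diff n U) fst"
    (is "etale_map ?G ?D fst") if P: "(n, U, P) \<in> plots Y" for n U P
    unfolding etale_map_def
  proof (intro conjI ballI, goal_cases)
    case 1
    then show ?case
      by (auto simp: points_pullback_domain) (simp add: domain_diff_def)
  next
    case (2 p)
    obtain r0 x0 where p: "p = (r0, x0)"
      by (cases p)
    then have r0: "r0 \<in> U" "x0 \<in> points X" "P r0 = f x0"
      using 2 by (auto simp: points_pullback_domain)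
    have U: "openin (Euclidean_space n) U"
      using plotD[OF Y P] by blast
    obtain S T where S: "D_open X S" "x0 \<in> S" and T: "D_open Y T" "f x0 \<in> T"
      and f: "diffeomorphism (subspace_diff X S) (subspace_diff Y T) f"
      using et r0(2) unfolding etale_map_def openin_D_topology by metis
    have SX: "S \<subseteq> points X" and TY: "T \<subseteq> points Y"
      using S(1) T(1) by (auto simp: D_open_def)
    have pts: "points (subspace_diff X S) = S" "points (subspace_diff Y T) = T"
      using SX TY by (auto simp: subspace_diff_def)
    have bij: "bij_betw f S T" and inv: "smooth (subspace_diff Y T) (subspace_diff X S) (inv_into S f)"
      using f by (auto simp: diffeomorphism_def pts)
    define \<tau> where "\<tau> = inv_into S f"
    have \<tau>: "\<tau> y \<in> S" "f (\<tau> y) = y" if "y \<in> T" for y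
      using bij that by (auto simp: \<tau>_def bij_betw_def inv_into_into f_inv_into_f)
    have \<tau>f: "\<tau> (f x) = x" if "x \<in> S" for x
      using bij that by (simp add: \<tau>_def bij_betw_def)
    define S' where "S' = {(r, x). r \<in> U \<and> x \<in> S \<and> P r = f x}"
    define T' where "T' = {r \<in> U. P r \<in> T}"
    have T': "openin (Euclidean_space n) T'" "T' \<subseteq> U"
      using D_open_preimage[OF T(1) P] by (auto simp: T'_def)
    have S'G: "S' \<subseteq> points ?G"
      using SX by (auto simp: S'_def points_pullback_domain)
    have "D_open ?G S'"
      unfolding D_open_def
    proof (intro conjI S'G ballI, clarify)
      fix m V Q assume Q: "(m, V, Q) \<in> plots ?G"
      then have Q': "(m, V, restrict (snd \<circ> Q) V) \<in> plots X" "smooth_map m V n U (\<lambda>v. fst (Q v))"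
        "\<forall>v\<in>V. P (fst (Q v)) = f (snd (Q v))"
        unfolding plots_pullback_domain[OF X] by blast+
      have "openin (Euclidean_space m) {v \<in> V. restrict (snd \<circ> Q) V v \<in> S}"
        by (rule D_open_preimage[OF S(1) Q'(1)])
      moreover have "{v \<in> V. restrict (snd \<circ> Q) V v \<in> S} = {v \<in> V. Q v \<in> S'}"
        using Q'(3) smooth_map_mem[OF Q'(2)] by (auto simp: S'_def case_prod_unfold)
      ultimately show "openin (Euclidean_space m) {v \<in> V. Q v \<in> S'}"
        by simp
    qed
    moreover have "D_open ?D T'"
      using T' by (simp add: D_open_domain_diff[OF U])
    moreover have "diffeomorphism (subspace_diff ?G S') (subspace_diff ?D T') fst"
    proof -
      have pts': "points (subspace_diff ?G S') = S'" "points (subspace_diff ?D T') = T'"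
        using S'G T'(2) by (auto simp: subspace_diff_def domain_diff_def)
      have S'T': "fst s \<in> T'" "s = (fst s, \<tau> (P (fst s)))" if "s \<in> S'" for s
        using that bij \<tau>f by (auto simp: S'_def T'_def bij_betw_def)
      have T'S': "(r, \<tau> (P r)) \<in> S'" if "r \<in> T'" for r
        using that \<tau> by (auto simp: S'_def T'_def)
      have bij': "bij_betw fst S' T'"
        by (rule bij_betwI[where g = "\<lambda>r. (r, \<tau> (P r))"]) (use S'T' T'S' in auto)
      \<comment> \<open>\<open>diffeomorphism\<close> speaks of \<open>inv_into\<close>, which
        injectivity of \<open>fst\<close> on \<open>S'\<close> identifies with the explicit
        inverse.\<close>
      have inv': "inv_into S' fst r = (r, \<tau> (P r))" if "r \<in> T'" for r
        using inv_into_f_f[OF bij_betw_imp_inj_on[OF bij'] T'S'[OF that]] by simp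
      have "smooth (subspace_diff ?G S') (subspace_diff ?D T') fst"
        unfolding smooth_def pts'
      proof (intro conjI ballI, goal_cases)
        case 1
        then show ?case
          using S'T' by blast
      next
        case (2 q)
        obtain m V Q where q: "q = (m, V, Q)"
          by (cases q)
        then have Q: "(m, V, Q) \<in> plots ?G" "Q ` V \<subseteq> S'"
          using 2 by (auto simp: subspace_diff_def)
        then have Q': "(m, V, restrict (snd \<circ> Q) V) \<in> plots X" "smooth_map m V n U (\<lambda>v. fst (Q v))"
          unfolding plots_pullback_domain[OF X] by blast+
        have V: "openin (Euclidean_space m) V"
          using plotD[OF X Q'(1)] by blast
        have im: "fst (Q v) \<in> T'" if "v \<in> V" for v
          using S'T'(1) Q(2) that by blast
        have "restrict (fst \<circ> Q) V \<in> V \<rightarrow>\<^sub>E U"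
          using smooth_map_mem[OF Q'(2)] by auto
        moreover have "smooth_map m V n U (restrict (fst \<circ> Q) V)"
          using Q'(2) by (simp add: smooth_map_restrict_iff[OF V] comp_def)
        ultimately have "(m, V, restrict (fst \<circ> Q) V) \<in> plots ?D"
          using V by (simp add: plots_domain_diff)
        then show ?case
          using im by (auto simp: q subspace_diff_def)
      qed
      moreover have "smooth (subspace_diff ?D T') (subspace_diff ?G S') (inv_into S' fst)"
        unfolding smooth_def pts'
      proof (intro conjI ballI, goal_cases)
        case 1
        then show ?case
          using inv' T'S' by simp
      next
        case (2 q)
        obtain m V F where q: "q = (m, V, F)"
          by (cases q)
        then have F: "smooth_map m V n U F" and V: "openin (Euclidean_space m) V" and FT': "F ` V \<subseteq> T'"
          using 2 by (auto simp: subspace_diff_def plots_domain_diff)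
        have "(m, V, restrict (P \<circ> F) V) \<in> plots (subspace_diff Y T)"
          using plot_compose[OF Y P V F] FT' by (auto simp: subspace_diff_def T'_def)
        then have "(m, V, restrict (\<tau> \<circ> restrict (P \<circ> F) V) V) \<in> plots X"
          using smooth_plot[OF inv] by (auto simp: subspace_diff_def \<tau>_def)
        moreover have "P (F v) = f (restrict (\<tau> \<circ> restrict (P \<circ> F) V) V v)" if "v \<in> V" for v
          using that FT' \<tau>(2) by (auto simp: T'_def)
        ultimately have "(m, V, restrict (\<lambda>v. (F v, restrict (\<tau> \<circ> restrict (P \<circ> F) V) V v)) V) \<in> plots ?G"
          by (intro pullback_plotI[OF X F])
        moreover have "restrict (\<lambda>v. (F v, restrict (\<tau> \<circ> restrict (P \<circ> F) V) V v)) V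
            = restrict (inv_into S' fst \<circ> F) V"
          using FT' inv' by (intro restrict_ext) auto
        ultimately show ?case
          using FT' inv' T'S' by (auto simp: q subspace_diff_def)
      qed
      ultimately show ?thesis
        using bij' by (simp add: diffeomorphism_def pts')
    qed
    moreover have "p \<in> S'" "fst p \<in> T'"
      using r0 S(2) T(2) by (auto simp: p S'_def T'_def)
    ultimately show ?case
      unfolding openin_D_topology by blast
  qed
  then show ?thesis
    using etale_map_imp_smooth[OF X Y et] unfolding diffeological_etale_map_def by auto
qed

text \<open>Every plot of a manifold factors locally through an inverse chart. So a plot
  \<open>Q\<close> of \<open>E\<close> lying over \<open>D\<close> satisfies
  \<open>\<pi> \<circ> Q = P \<circ> F\<close> with
  \<open>F = \<phi> \<circ> \<pi> \<circ> Q\<close>, where \<open>P\<close> is the inverse chart.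
  Comparing \<open>Q\<close> with \<open>L \<circ> F\<close> shows that the image of the lift
  \<open>L\<close> is D-open in \<open>E\<close>.\<close>

lemma diffeological_etale_manifold_imp_etale:
  assumes E: "diffeological_space E" and \<A>: "smooth_atlas M \<A>"
    and et: "diffeological_etale_map E (manifold_diff M \<A>) \<pi>" (is "diffeological_etale_map E ?M \<pi>")
  shows "etale_map E ?M \<pi>"
  unfolding etale_map_def
proof (intro conjI ballI)
  note M = diffeological_space_manifold_diff[OF \<A>]
  have sm: "smooth E ?M \<pi>"
    using et by (simp add: diffeological_etale_map_def)
  then show \<pi>: "\<pi> \<in> points E \<rightarrow> points ?M"
    by (simp add: smooth_def)
  fix e assume e: "e \<in> points E"
  then have "\<pi> e \<in> (\<Union>(n, D, \<phi>)\<in>\<A>. D)"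
    using \<pi> \<A> unfolding smooth_atlas_def by auto
  then obtain n D \<phi> where ch: "(n, D, \<phi>) \<in> \<A>" and eD: "\<pi> e \<in> D"
    by auto
  note D = smooth_atlasD[OF \<A> ch]
  let ?U = "\<phi> ` D"
  let ?P = "restrict (inv_into D \<phi>) ?U"
  have P: "(n, ?U, ?P) \<in> plots ?M"
    by (rule chart_inverse_plot[OF \<A> ch])
  have P\<phi>: "?P (\<phi> d) = d" if "d \<in> D" for d
    using D(2) that by simp
  have \<phi>P: "?P r \<in> D" "\<phi> (?P r) = r" if "r \<in> ?U" for r
    using that P\<phi> by auto
  obtain T L where T: "openin (Euclidean_space n) T" "\<phi> (\<pi> e) \<in> T" "T \<subseteq> ?U" "(n, T, L) \<in> plots E"
    and \<pi>L: "\<And>r. r \<in> T \<Longrightarrow> \<pi> (L r) = ?P r" and Le: "L (\<phi> (\<pi> e)) = e"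
    and graph: "D_open (pullback (domain_diff n ?U) ?P E \<pi>) {(r, x). r \<in> T \<and> x = L r}"
  proof (rule diffeological_etale_lift[OF E M et P _ e])
    show "\<phi> (\<pi> e) \<in> ?U"
      using eD by simp
    show "?P (\<phi> (\<pi> e)) = \<pi> e"
      by (rule P\<phi>[OF eD])
  qed blast
  define S where "S = L ` T"
  define T' where "T' = {p \<in> D. \<phi> p \<in> T}"
  have LE: "L t \<in> points E" if "t \<in> T" for t
    using PiE_mem[OF plotD(2)[OF E T(4)] that] .
  have \<phi>\<pi>L: "\<pi> (L t) \<in> T'" "\<phi> (\<pi> (L t)) = t" if "t \<in> T" for t
    using \<phi>P[of t] \<pi>L[OF that] T(3) that by (auto simp: T'_def)
  have L\<phi>: "L (\<phi> p) \<in> S" "\<pi> (L (\<phi> p)) = p" if "p \<in> T'" for p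
    using that \<pi>L[of "\<phi> p"] P\<phi>[of p] by (auto simp: T'_def S_def)
  have S: "D_open E S"
    unfolding D_open_def
  proof (intro conjI ballI, goal_cases)
    case 1
    then show ?case
      using LE by (auto simp: S_def)
  next
    case (2 q)
    obtain m V Q where q: "q = (m, V, Q)"
      by (cases q)
    with 2 have Q: "(m, V, Q) \<in> plots E"
      by simp
    let ?R = "restrict (\<pi> \<circ> Q) V"
    let ?V = "{v \<in> V. ?R v \<in> D}"
    have R: "(m, V, ?R) \<in> plots ?M"
      using sm Q unfolding smooth_def by blast
    have V': "openin (Euclidean_space m) ?V"
      by (rule manifold_plotD(3)[OF R ch])
    have F: "smooth_map m ?V n ?U (\<phi> \<circ> ?R)"
      by (rule manifold_plotD(4)[OF R ch])
    have Q': "(m, ?V, restrict Q ?V) \<in> plots E"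
      by (rule plot_subset[OF E Q V']) auto
    have "openin (Euclidean_space m) {v \<in> ?V. (\<phi> \<circ> ?R) v \<in> T \<and> restrict Q ?V v = L ((\<phi> \<circ> ?R) v)}"
    proof (rule lift_unique[OF E graph Q' F])
      fix v assume v: "v \<in> ?V"
      then show "\<pi> (restrict Q ?V v) = ?P ((\<phi> \<circ> ?R) v)"
        using P\<phi>[of "\<pi> (Q v)"] by auto
    qed
    \<comment> \<open>A point \<open>L t\<close> determines \<open>t\<close> as
      \<open>\<phi> (\<pi> (L t))\<close>. Hence a value of \<open>Q\<close> in \<open>S\<close> can
      only be the value of \<open>L\<close> at the coordinates of its projection.\<close>
    moreover have "{v \<in> ?V. (\<phi> \<circ> ?R) v \<in> T \<and> restrict Q ?V v = L ((\<phi> \<circ> ?R) v)} = {v \<in> V. Q v \<in> S}"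
    proof (intro Collect_cong iffI)
      fix v assume "v \<in> V \<and> Q v \<in> S"
      then obtain t where t: "v \<in> V" "t \<in> T" "Q v = L t"
        by (auto simp: S_def)
      then show "v \<in> ?V \<and> (\<phi> \<circ> ?R) v \<in> T \<and> restrict Q ?V v = L ((\<phi> \<circ> ?R) v)"
        using \<phi>\<pi>L[OF t(2)] by (simp add: T'_def)
    qed (auto simp: S_def)
    ultimately show ?case
      by (simp add: q)
  qed
  have T'M: "D_open ?M T'"
    unfolding D_open_def
  proof (intro conjI ballI, goal_cases)
    case 1
    then show ?case
      using D(1) by (auto simp: T'_def)
  next
    case (2 q)
    obtain m V R where q: "q = (m, V, R)"
      by (cases q)
    with 2 have R: "(m, V, R) \<in> plots ?M"
      by simp
    have "openin (Euclidean_space m) {v \<in> {v \<in> V. R v \<in> D}. (\<phi> \<circ> R) v \<in> T}"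
      by (rule smooth_map_openin_preimage[OF manifold_plotD(3)[OF R ch] D(3) manifold_plotD(4)[OF R ch] T(1)])
    moreover have "{v \<in> {v \<in> V. R v \<in> D}. (\<phi> \<circ> R) v \<in> T} = {v \<in> V. R v \<in> T'}"
      by (auto simp: T'_def)
    ultimately show ?case
      by (simp add: q)
  qed
  have pts: "points (subspace_diff E S) = S" "points (subspace_diff ?M T') = T'"
    using S T'M by (auto simp: subspace_diff_def D_open_def)
  have bij: "bij_betw \<pi> S T'"
    by (rule bij_betwI[where g = "\<lambda>p. L (\<phi> p)"]) (use \<phi>\<pi>L L\<phi> in \<open>auto simp: S_def\<close>)
  have inv: "inv_into S \<pi> p = L (\<phi> p)" if "p \<in> T'" for p
    using inv_into_f_f[OF bij_betw_imp_inj_on[OF bij] L\<phi>(1)[OF that]] L\<phi>(2)[OF that] by simp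
  have "smooth (subspace_diff E S) (subspace_diff ?M T') \<pi>"
    unfolding smooth_def pts
  proof (intro conjI ballI, goal_cases)
    case 1
    then show ?case
      using bij by (auto simp: bij_betw_def)
  next
    case (2 q)
    obtain m V Q where q: "q = (m, V, Q)"
      by (cases q)
    with 2 have Q: "(m, V, Q) \<in> plots E" "Q ` V \<subseteq> S"
      by (auto simp: subspace_diff_def)
    have "(m, V, restrict (\<pi> \<circ> Q) V) \<in> plots ?M"
      using sm Q unfolding smooth_def by blast
    then show ?case
      using Q(2) bij by (auto simp: q subspace_diff_def bij_betw_def)
  qed
  moreover have "smooth (subspace_diff ?M T') (subspace_diff E S) (inv_into S \<pi>)"
    unfolding smooth_def pts
  proof (intro conjI ballI, goal_cases)
    case 1
    then show ?case
      using inv L\<phi>(1) by simp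
  next
    case (2 q)
    obtain m V R where q: "q = (m, V, R)"
      by (cases q)
    with 2 have R: "(m, V, R) \<in> plots ?M" "R ` V \<subseteq> T'"
      by (auto simp: subspace_diff_def)
    have V: "openin (Euclidean_space m) V"
      by (rule manifold_plotD(1)[OF R(1)])
    have "{v \<in> V. R v \<in> D} = V"
      using R(2) by (auto simp: T'_def)
    then have "smooth_map m V n ?U (\<phi> \<circ> R)"
      using manifold_plotD(4)[OF R(1) ch] by simp
    then have "smooth_map m V n T (\<phi> \<circ> R)"
      by (rule smooth_map_subset) (use R(2) in \<open>auto simp: T'_def\<close>)
    then have "(m, V, restrict (L \<circ> (\<phi> \<circ> R)) V) \<in> plots E"
      by (rule plot_compose[OF E T(4) V])
    moreover have "restrict (L \<circ> (\<phi> \<circ> R)) V = restrict (inv_into S \<pi> \<circ> R) V"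
      by (rule restrict_ext) (use R(2) inv in auto)
    moreover have "(inv_into S \<pi> \<circ> R) ` V \<subseteq> S"
      using R(2) inv L\<phi>(1) by auto
    ultimately show ?case
      by (simp add: q subspace_diff_def)
  qed
  ultimately have "diffeomorphism (subspace_diff E S) (subspace_diff ?M T') \<pi>"
    using bij by (simp add: diffeomorphism_def pts)
  moreover have "e \<in> S" "\<pi> e \<in> T'"
    using T(2) image_eqI[of e L, OF Le[symmetric] T(2)] eD by (simp_all add: S_def T'_def)
  ultimately show "\<exists>S T. openin (D_topology E) S \<and> e \<in> S \<and> openin (D_topology ?M) T \<and> \<pi> e \<in> T \<and>
      diffeomorphism (subspace_diff E S) (subspace_diff ?M T) \<pi>"
    using S T'M unfolding openin_D_topology by blast
qed

section \<open>Internal tangent spaces\<close>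

lemma lookup_scaleR: "Poly_Mapping.lookup (c *\<^sub>R v) k = c *\<^sub>R Poly_Mapping.lookup v k"
proof -
  have "finite {k. c *\<^sub>R Poly_Mapping.lookup v k \<noteq> 0}"
    by (rule finite_subset[OF _ finite_lookup[of v]]) auto
  then show ?thesis
    by (simp add: scaleR_poly_mapping_def)
qed

text \<open>The linear map taking the basis vector at \<open>k\<close> to the one at
  \<open>h k\<close>; coordinates whose indices acquire the same image are added. An operation
  \<open>g\<close> on plots acts on direct sums through \<open>h = map_prod g id\<close>, which
  keeps the coordinate number.\<close>

definition reindex :: "('a \<Rightarrow> 'b) \<Rightarrow> ('a \<Rightarrow>\<^sub>0 real) \<Rightarrow> ('b \<Rightarrow>\<^sub>0 real)" where
  "reindex h v = (\<Sum>k\<in>Poly_Mapping.keys v. Poly_Mapping.single (h k) (Poly_Mapping.lookup v k))"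

text \<open>Keys may cancel in a sum of families, so additivity needs all the families summed over a
  common finite set.\<close>

lemma reindex_superset:
  assumes "finite K" and "Poly_Mapping.keys v \<subseteq> K"
  shows "reindex h v = (\<Sum>k\<in>K. Poly_Mapping.single (h k) (Poly_Mapping.lookup v k))"
  unfolding reindex_def using assms by (intro sum.mono_neutral_left) (auto simp: in_keys_iff)

lemma linear_reindex: "linear (reindex h)"
proof (rule linearI)
  fix v w :: "'a \<Rightarrow>\<^sub>0 real"
  let ?K = "Poly_Mapping.keys v \<union> Poly_Mapping.keys w"
  have "Poly_Mapping.keys (v + w) \<subseteq> ?K"
    by (rule keys_add)
  then show "reindex h (v + w) = reindex h v + reindex h w"
    by (simp add: reindex_superset[of ?K] lookup_add single_add sum.distrib)
next
  fix c :: real and v :: "'a \<Rightarrow>\<^sub>0 real"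
  have "Poly_Mapping.keys (c *\<^sub>R v) \<subseteq> Poly_Mapping.keys v"
    by (auto simp: in_keys_iff lookup_scaleR)
  moreover have "Poly_Mapping.single k (c * x) = c *\<^sub>R Poly_Mapping.single k x" for k :: 'b and x
    by (rule poly_mapping_eqI) (simp add: lookup_scaleR lookup_single when_def)
  ultimately show "reindex h (c *\<^sub>R v) = c *\<^sub>R reindex h v"
    by (simp add: reindex_superset[of "Poly_Mapping.keys v"] lookup_scaleR scaleR_sum_right)
qed

lemma reindex_single [simp]:
  "reindex h (Poly_Mapping.single k c) = Poly_Mapping.single (h k) c"
  by (cases "c = 0") (simp_all add: reindex_def)

lemma poly_mapping_eq_sum_single:
  fixes v :: "'a \<Rightarrow>\<^sub>0 real"
  shows "v = (\<Sum>k\<in>Poly_Mapping.keys v. Poly_Mapping.single k (Poly_Mapping.lookup v k))"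
proof (rule poly_mapping_eqI)
  fix j
  show "Poly_Mapping.lookup v j =
      Poly_Mapping.lookup (\<Sum>k\<in>Poly_Mapping.keys v. Poly_Mapping.single k (Poly_Mapping.lookup v k)) j"
    by (simp add: lookup_sum lookup_single when_def in_keys_iff)
qed

text \<open>A family is the finite sum of its coordinates, so multiples of basis vectors suffice as
  tests. Taking \<open>R\<close> to be 0 compares two linear maps through their difference.\<close>

lemma linear_image_in_subspace:
  fixes f :: "('a \<Rightarrow>\<^sub>0 real) \<Rightarrow> 'b::real_vector"
  assumes "linear f" and "subspace R"
    and "\<And>k c. k \<in> Poly_Mapping.keys v \<Longrightarrow> f (Poly_Mapping.single k c) \<in> R"
  shows "f v \<in> R"
proof -
  have "f v = (\<Sum>k\<in>Poly_Mapping.keys v. f (Poly_Mapping.single k (Poly_Mapping.lookup v k)))"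
    using linear_sum[OF assms(1)] poly_mapping_eq_sum_single[of v] by metis
  then show ?thesis
    using subspace_sum[OF assms(2)] assms(3) by (metis (no_types, lifting))
qed

lemma summand_unit:
  "i < fst p \<Longrightarrow> summand p (\<lambda>j. if j = i then c else 0) = Poly_Mapping.single (p, i) c"
proof -
  assume "i < fst p"
  have "summand p (\<lambda>j. if j = i then c else 0) =
      (\<Sum>j<fst p. if j = i then Poly_Mapping.single (p, i) c else 0)"
    unfolding summand_def by (rule sum.cong) auto
  then show ?thesis
    using \<open>i < fst p\<close> by simp
qed

lemma reindex_summand:
  "fst (g p) = fst p \<Longrightarrow> reindex (map_prod g id) (summand p u) = summand (g p) u"
  by (simp add: summand_def linear_sum[OF linear_reindex])

lemma subspace_direct_sum: "subspace (direct_sum X x)"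
proof (rule subspaceI)
  fix v w assume "v \<in> direct_sum X x" "w \<in> direct_sum X x"
  then show "v + w \<in> direct_sum X x"
    using keys_add[of v w] unfolding direct_sum_def by blast
next
  fix c v assume "v \<in> direct_sum X x"
  moreover have "Poly_Mapping.keys (c *\<^sub>R v) \<subseteq> Poly_Mapping.keys v"
    by (auto simp: in_keys_iff lookup_scaleR)
  ultimately show "c *\<^sub>R v \<in> direct_sum X x"
    unfolding direct_sum_def by blast
qed (simp add: direct_sum_def)

lemma direct_sum_key:
  "v \<in> direct_sum X x \<Longrightarrow> (p, i) \<in> Poly_Mapping.keys v \<Longrightarrow> p \<in> centered_plots X x \<and> i < fst p"
  by (auto simp: direct_sum_def)

lemma single_in_direct_sum:
  "p \<in> centered_plots X x \<Longrightarrow> i < fst p \<Longrightarrow> Poly_Mapping.single (p, i) c \<in> direct_sum X x"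
  by (auto simp: direct_sum_def split: if_splits)

lemma linear_image_direct_sum:
  assumes "linear f" and "subspace R" and "v \<in> direct_sum X x"
    and "\<And>p i c. p \<in> centered_plots X x \<Longrightarrow> i < fst p \<Longrightarrow> f (Poly_Mapping.single (p, i) c) \<in> R"
  shows "f v \<in> R"
proof (rule linear_image_in_subspace[OF assms(1,2)])
  fix k c assume "k \<in> Poly_Mapping.keys v"
  then show "f (Poly_Mapping.single k c) \<in> R"
    using direct_sum_key[OF assms(3)] assms(4) by (cases k) simp
qed

section \<open>Relations and classes in the colimit\<close>

lemma subspace_colimit_relations: "subspace (colimit_relations X x)"
  by (simp add: colimit_relations_def)

lemma morphism_relation:
  assumes "q \<in> centered_plots X x" and "p \<in> centered_plots X x" and "plot_morphism q p W F"
    and "u \<in> topspace (Euclidean_space (fst q))"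
  shows "summand q u - summand p (jacobian (fst q) F (\<lambda>_. 0) u) \<in> colimit_relations X x"
  unfolding colimit_relations_def using assms by (intro span_base) blast

lemma jacobian_ident:
  assumes "j < n"
  shows "jacobian n (\<lambda>r. r) x u j = u j"
proof -
  have "deriv (\<lambda>t. (x(i := t)) j) (x i) = (if i = j then 1 else 0)" for i
    by (cases "i = j") simp_all
  then have "jacobian n (\<lambda>r. r) x u j = (\<Sum>i<n. if i = j then u i else 0)"
    unfolding jacobian_def by (intro sum.cong) simp_all
  then show ?thesis
    using assms by simp
qed

text \<open>The identity germ has the identity as its differential. So two plots agreeing near 0
  have the same tangent vectors in the colimit, even if their domains differ.\<close>

lemma ident_morphism_relation:
  assumes q: "q \<in> centered_plots X x" and p: "p \<in> centered_plots X x"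
    and mor: "plot_morphism q p W (\<lambda>r. r)" and dim: "fst q = fst p" "i < fst p"
  shows "Poly_Mapping.single (q, i) c - Poly_Mapping.single (p, i) c \<in> colimit_relations X x"
proof -
  let ?u = "\<lambda>j. if j = i then c else 0 :: real"
  have "?u \<in> topspace (Euclidean_space (fst q))"
    using dim by (simp add: topspace_Euclidean_space)
  from morphism_relation[OF q p mor this]
  have "summand q ?u - summand p (jacobian (fst q) (\<lambda>r. r) (\<lambda>_. 0) ?u) \<in> colimit_relations X x" .
  moreover have "summand p (jacobian (fst q) (\<lambda>r. r) (\<lambda>_. 0) ?u) = summand p ?u"
    unfolding summand_def by (rule sum.cong) (simp_all add: jacobian_ident dim(1))
  ultimately show ?thesis
    using summand_unit[of i p c] summand_unit[of i q c] dim by simp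
qed

lemma tangent_class_eq_iff:
  "tangent_class X x v = tangent_class X x w \<longleftrightarrow> v - w \<in> colimit_relations X x" (is "?L \<longleftrightarrow> ?R")
proof
  note R = subspace_colimit_relations[of X x]
  assume ?L
  moreover have "v \<in> tangent_class X x v"
    using subspace_0[OF R] by (simp add: tangent_class_def)
  ultimately show ?R
    by (auto simp: tangent_class_def)
next
  note R = subspace_colimit_relations[of X x]
  assume vw: ?R
  have "a - v \<in> colimit_relations X x \<longleftrightarrow> a - w \<in> colimit_relations X x" for a
    using subspace_add[OF R _ vw, of "a - v"] subspace_diff[OF R _ vw, of "a - w"] by auto
  then show ?L
    by (simp add: tangent_class_def)
qed

lemma tangent_add_class:
  "tangent_add (tangent_class X x v) (tangent_class X x w) = tangent_class X x (v + w)"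
proof (intro equalityI subsetI)
  note R = subspace_colimit_relations[of X x]
  fix a assume "a \<in> tangent_add (tangent_class X x v) (tangent_class X x w)"
  then obtain b c where "a = b + c" "b - v \<in> colimit_relations X x" "c - w \<in> colimit_relations X x"
    by (auto simp: tangent_add_def tangent_class_def)
  then show "a \<in> tangent_class X x (v + w)"
    using subspace_add[OF R, of "b - v" "c - w"] by (simp add: tangent_class_def algebra_simps)
next
  note R = subspace_colimit_relations[of X x]
  fix a assume "a \<in> tangent_class X x (v + w)"
  then have "a - w \<in> tangent_class X x v"
    by (simp add: tangent_class_def algebra_simps)
  moreover have "w \<in> tangent_class X x w"
    using subspace_0[OF R] by (simp add: tangent_class_def)
  ultimately show "a \<in> tangent_add (tangent_class X x v) (tangent_class X x w)"
    unfolding tangent_add_def by force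
qed

lemma tangent_scale_class: "tangent_scale X x c (tangent_class X x v) = tangent_class X x (c *\<^sub>R v)"
proof (intro equalityI subsetI)
  note R = subspace_colimit_relations[of X x]
  fix a assume "a \<in> tangent_scale X x c (tangent_class X x v)"
  then obtain b w where "a = c *\<^sub>R b + w" "b - v \<in> colimit_relations X x" "w \<in> colimit_relations X x"
    by (auto simp: tangent_scale_def tangent_class_def)
  then have "c *\<^sub>R (b - v) + w \<in> colimit_relations X x" "a - c *\<^sub>R v = c *\<^sub>R (b - v) + w"
    using subspace_add[OF R subspace_scale[OF R]] by (blast, simp add: scaleR_diff_right)
  then show "a \<in> tangent_class X x (c *\<^sub>R v)"
    by (simp add: tangent_class_def)
next
  note R = subspace_colimit_relations[of X x]
  fix a assume "a \<in> tangent_class X x (c *\<^sub>R v)"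
  moreover have "v \<in> tangent_class X x v"
    using subspace_0[OF R] by (simp add: tangent_class_def)
  moreover have "a = c *\<^sub>R v + (a - c *\<^sub>R v)"
    by simp
  ultimately show "a \<in> tangent_scale X x c (tangent_class X x v)"
    unfolding tangent_scale_def tangent_class_def by blast
qed

section \<open>The internal tangent map on classes\<close>

definition push_plot :: "('a \<Rightarrow> 'b) \<Rightarrow> 'a param \<Rightarrow> 'b param" where
  "push_plot f = (\<lambda>(n, U, P). (n, U, restrict (f \<circ> P) U))"

lemma push_plot_simp: "push_plot f (n, U, P) = (n, U, restrict (f \<circ> P) U)"
  by (simp add: push_plot_def)

lemma fst_push_plot [simp]: "fst (push_plot f p) = fst p"
  by (cases p) (simp add: push_plot_def)

lemma push_plot_centered:
  "smooth X Y f \<Longrightarrow> p \<in> centered_plots X x \<Longrightarrow> push_plot f p \<in> centered_plots Y (f x)"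
  by (auto simp: centered_plots_def push_plot_def smooth_def)

lemma plot_morphism_push_plot:
  assumes "plot_morphism q p W F"
  shows "plot_morphism (push_plot f q) (push_plot f p) W F"
proof -
  obtain m V Q where q: "q = (m, V, Q)"
    by (cases q)
  obtain n U P where p: "p = (n, U, P)"
    by (cases p)
  have "F r \<in> U" if "r \<in> W" for r
    using assms that smooth_map_mem[of m W n U F r] by (simp add: q p)
  then show ?thesis
    using assms by (auto simp: q p push_plot_simp)
qed

text \<open>A generating relation involves the morphism only through the Jacobian of
  \<open>F\<close> at 0. If \<open>g\<close> allows the same \<open>F\<close>, possibly on another
  neighbourhood \<open>W'\<close>, generators go to generators.\<close>

lemma reindex_colimit_relations:
  assumes cen: "\<And>p. p \<in> centered_plots X x \<Longrightarrow> g p \<in> centered_plots Y y \<and> fst (g p) = fst p"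
    and mor: "\<And>q p W F. q \<in> centered_plots X x \<Longrightarrow> p \<in> centered_plots X x \<Longrightarrow> plot_morphism q p W F \<Longrightarrow>
      \<exists>W'. plot_morphism (g q) (g p) W' F"
    and v: "v \<in> colimit_relations X x"
  shows "reindex (map_prod g id) v \<in> colimit_relations Y y"
proof -
  let ?h = "reindex (map_prod g id)"
  have "colimit_relations X x \<subseteq> {v. ?h v \<in> colimit_relations Y y}"
    unfolding colimit_relations_def[of X x]
  proof (intro span_minimal subsetI)
    show "subspace {v. ?h v \<in> colimit_relations Y y}"
      using linear_subspace_vimage[OF linear_reindex[of "map_prod g id"] subspace_colimit_relations[of Y y]]
      by (simp add: vimage_def)
  next
    fix v assume "v \<in> {summand q u - summand p (jacobian (fst q) F (\<lambda>_. 0) u) | q p W F u.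
       q \<in> centered_plots X x \<and> p \<in> centered_plots X x \<and> plot_morphism q p W F \<and>
       u \<in> topspace (Euclidean_space (fst q))}"
    then obtain q p W F u where v: "v = summand q u - summand p (jacobian (fst q) F (\<lambda>_. 0) u)"
      and q: "q \<in> centered_plots X x" and p: "p \<in> centered_plots X x" and F: "plot_morphism q p W F"
      and u: "u \<in> topspace (Euclidean_space (fst q))"
      by blast
    obtain W' where "plot_morphism (g q) (g p) W' F"
      using mor[OF q p F] by blast
    then have "summand (g q) u - summand (g p) (jacobian (fst (g q)) F (\<lambda>_. 0) u) \<in> colimit_relations Y y"
      using cen[OF q] cen[OF p] u by (intro morphism_relation) simp_all
    then have "?h v \<in> colimit_relations Y y"
      using cen[OF q] cen[OF p] by (simp add: v linear_diff[OF linear_reindex] reindex_summand)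
    then show "v \<in> {v. ?h v \<in> colimit_relations Y y}"
      by simp
  qed
  then show ?thesis
    using v by blast
qed

lemma reindex_direct_sum:
  assumes "\<And>p. p \<in> centered_plots X x \<Longrightarrow> g p \<in> centered_plots Y y \<and> fst (g p) = fst p"
    and "v \<in> direct_sum X x"
  shows "reindex (map_prod g id) v \<in> direct_sum Y y"
  using assms(1)
  by (intro linear_image_direct_sum[OF linear_reindex subspace_direct_sum assms(2)])
    (simp add: single_in_direct_sum)

lemma tangent_spaceE:
  assumes "A \<in> tangent_space X x"
  obtains v where "v \<in> direct_sum X x" and "A = tangent_class X x v"
  using assms by (auto simp: tangent_space_def)

lemma tangent_class_in_space: "v \<in> direct_sum X x \<Longrightarrow> tangent_class X x v \<in> tangent_space X x"
  by (simp add: tangent_space_def)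

text \<open>\<open>L\<close> is additive for the operations on classes, so its expansion over basis
  vectors is an induction on finite sets of keys, carried out together with membership of the
  partial sums in the direct sum.\<close>

lemma tangent_linear_class:
  assumes lin: "tangent_linear X x Y y L"
    and gen: "\<And>p i c. p \<in> centered_plots X x \<Longrightarrow> i < fst p \<Longrightarrow>
      L (tangent_class X x (Poly_Mapping.single (p, i) c)) = tangent_class Y y (f (Poly_Mapping.single (p, i) c))"
    and f: "linear f" and v: "v \<in> direct_sum X x"
  shows "L (tangent_class X x v) = tangent_class Y y (f v)"
proof -
  have add: "L (tangent_class X x (a + b)) = tangent_add (L (tangent_class X x a)) (L (tangent_class X x b))"
    if "a \<in> direct_sum X x" "b \<in> direct_sum X x" for a b
    using lin tangent_class_in_space[OF that(1)] tangent_class_in_space[OF that(2)]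
    unfolding tangent_linear_def tangent_add_class[symmetric] by blast
  \<comment> \<open>Homogeneity for the scalar 0 settles this, whatever class \<open>L\<close>
    assigns to the zero class.\<close>
  have zero: "L (tangent_class X x 0) = tangent_class Y y 0"
  proof -
    have 0: "tangent_class X x 0 \<in> tangent_space X x"
      by (intro tangent_class_in_space subspace_0[OF subspace_direct_sum])
    then have "L (tangent_class X x 0) \<in> tangent_space Y y"
      using lin by (auto simp: tangent_linear_def)
    then obtain w where w: "L (tangent_class X x 0) = tangent_class Y y w"
      by (rule tangent_spaceE)
    have "L (tangent_scale X x 0 (tangent_class X x 0)) = tangent_scale Y y 0 (L (tangent_class X x 0))"
      using lin 0 by (simp add: tangent_linear_def)
    then show ?thesis
      by (simp add: w tangent_scale_class)
  qed
  define s where "s k = Poly_Mapping.single k (Poly_Mapping.lookup v k)" for k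
  have s: "s k \<in> direct_sum X x" "L (tangent_class X x (s k)) = tangent_class Y y (f (s k))"
    if "k \<in> Poly_Mapping.keys v" for k
    using direct_sum_key[OF v] that gen unfolding s_def
    by (cases k; simp add: single_in_direct_sum)+
  have "sum s K \<in> direct_sum X x \<and> L (tangent_class X x (sum s K)) = tangent_class Y y (f (sum s K))"
    if "finite K" "K \<subseteq> Poly_Mapping.keys v" for K
    using that
  proof (induction K rule: finite_induct)
    case empty
    then show ?case
      using zero by (simp add: linear_0[OF f] subspace_0[OF subspace_direct_sum])
  next
    case (insert k K)
    then show ?case
      using s[of k] subspace_add[OF subspace_direct_sum, of "s k" X x "sum s K"]
      by (simp add: add linear_add[OF f] tangent_add_class)
  qed
  from this[OF finite_keys order_refl] show ?thesis
    using poly_mapping_eq_sum_single[of v] by (simp add: s_def)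
qed

text \<open>Existence: reindexing along \<open>push_plot f\<close> respects the relations and so
  descends to classes. Uniqueness: the values prescribed on plots cover the basis vectors.
  Afterwards the tangent map can be computed on representatives.\<close>

lemma tangent_map_class:
  assumes f: "smooth X Y f"
  shows "tangent_linear X x Y (f x) (tangent_map X Y f x)"
    and "v \<in> direct_sum X x \<Longrightarrow> tangent_map X Y f x (tangent_class X x v) =
      tangent_class Y (f x) (reindex (map_prod (push_plot f) id) v)"
proof -
  let ?h = "reindex (map_prod (push_plot f) id)"
  have cen: "push_plot f p \<in> centered_plots Y (f x) \<and> fst (push_plot f p) = fst p"
    if "p \<in> centered_plots X x" for p
    using push_plot_centered[OF f that] by simp
  have rel: "?h v \<in> colimit_relations Y (f x)" if "v \<in> colimit_relations X x" for v
    by (rule reindex_colimit_relations[OF cen _ that]) (use plot_morphism_push_plot in blast)+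
  have h_diff: "?h (v - w) = ?h v - ?h w" for v w :: "'a plot_sum"
    by (rule linear_diff[OF linear_reindex])
  \<comment> \<open>The fact \<open>rel\<close> makes the choice of representative immaterial. The
    restriction provides the extensionality that the description demands.\<close>
  define L0 where "L0 = restrict (\<lambda>A. tangent_class Y (f x) (?h (SOME v. v \<in> direct_sum X x \<and> A = tangent_class X x v)))
    (tangent_space X x)"
  have L0: "L0 (tangent_class X x v) = tangent_class Y (f x) (?h v)" if v: "v \<in> direct_sum X x" for v
  proof -
    define w where "w = (SOME w. w \<in> direct_sum X x \<and> tangent_class X x v = tangent_class X x w)"
    have "w \<in> direct_sum X x \<and> tangent_class X x v = tangent_class X x w"
      unfolding w_def by (rule someI[of _ v]) (simp add: v)
    then have "w - v \<in> colimit_relations X x"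
      using tangent_class_eq_iff[of X x w v] by simp
    from rel[OF this] have "tangent_class Y (f x) (?h w) = tangent_class Y (f x) (?h v)"
      by (simp add: tangent_class_eq_iff h_diff)
    then show ?thesis
      using tangent_class_in_space[OF v] by (simp add: L0_def w_def)
  qed
  have hd: "?h v \<in> direct_sum Y (f x)" if "v \<in> direct_sum X x" for v
    by (rule reindex_direct_sum[OF cen that])
  have lin: "tangent_linear X x Y (f x) L0"
    unfolding tangent_linear_def
  proof (intro conjI ballI allI)
    show "L0 \<in> tangent_space X x \<rightarrow> tangent_space Y (f x)"
      by (auto elim!: tangent_spaceE simp: L0 hd tangent_class_in_space)
    fix A assume "A \<in> tangent_space X x"
    then obtain v where v: "v \<in> direct_sum X x" "A = tangent_class X x v"
      by (rule tangent_spaceE)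
    show "L0 (tangent_scale X x c A) = tangent_scale Y (f x) c (L0 A)" for c
      using v subspace_scale[OF subspace_direct_sum v(1)]
      by (simp add: L0 tangent_scale_class linear_scale[OF linear_reindex])
    fix B assume "B \<in> tangent_space X x"
    then obtain w where w: "w \<in> direct_sum X x" "B = tangent_class X x w"
      by (rule tangent_spaceE)
    show "L0 (tangent_add A B) = tangent_add (L0 A) (L0 B)"
      using v w subspace_add[OF subspace_direct_sum v(1) w(1)]
      by (simp add: L0 tangent_add_class linear_add[OF linear_reindex])
  qed
  have summand: "summand p u \<in> direct_sum X x" if "p \<in> centered_plots X x" for p u
    unfolding summand_def using that
    by (intro subspace_sum[OF subspace_direct_sum]) (simp add: single_in_direct_sum)
  have plot: "L0 (plot_tangent X x p u) = plot_tangent Y (f x) (push_plot f p) u"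
    if "p \<in> centered_plots X x" for p u
    using summand[OF that] by (simp add: plot_tangent_def L0 reindex_summand)
  have "tangent_map X Y f x = L0"
    unfolding tangent_map_def
  proof (rule the_equality, intro conjI)
    show "L0 \<in> extensional (tangent_space X x)"
      by (simp add: L0_def)
    show "\<forall>(n, U, P)\<in>centered_plots X x. \<forall>u\<in>topspace (Euclidean_space n).
        L0 (plot_tangent X x (n, U, P) u) = plot_tangent Y (f x) (n, U, restrict (f \<circ> P) U) u"
      using plot by (auto simp: push_plot_simp)
  next
    fix L assume L: "L \<in> extensional (tangent_space X x) \<and> tangent_linear X x Y (f x) L \<and>
     (\<forall>(n, U, P)\<in>centered_plots X x. \<forall>u\<in>topspace (Euclidean_space n).
        L (plot_tangent X x (n, U, P) u) = plot_tangent Y (f x) (n, U, restrict (f \<circ> P) U) u)"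
    have gen: "L (tangent_class X x (Poly_Mapping.single (p, i) c)) =
        tangent_class Y (f x) (?h (Poly_Mapping.single (p, i) c))"
      if p: "p \<in> centered_plots X x" and i: "i < fst p" for p i c
    proof -
      let ?u = "\<lambda>j. if j = i then c else 0 :: real"
      obtain n U P where pe: "p = (n, U, P)"
        by (cases p)
      have "?u \<in> topspace (Euclidean_space n)"
        using i by (simp add: pe topspace_Euclidean_space)
      moreover have "\<forall>u\<in>topspace (Euclidean_space n).
          L (plot_tangent X x p u) = plot_tangent Y (f x) (push_plot f p) u"
        using L p unfolding pe push_plot_simp by fast
      ultimately have "L (plot_tangent X x p ?u) = plot_tangent Y (f x) (push_plot f p) ?u"
        by blast
      then show ?thesis
        using i by (simp add: plot_tangent_def summand_unit)
    qed
    have "L (tangent_class X x v) = L0 (tangent_class X x v)" if v: "v \<in> direct_sum X x" for v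
    proof -
      have "tangent_linear X x Y (f x) L"
        using L by blast
      from tangent_linear_class[OF this gen linear_reindex v] show ?thesis
        unfolding L0[OF v] .
    qed
    then have "L A = L0 A" if "A \<in> tangent_space X x" for A
      using that by (auto elim: tangent_spaceE)
    then show "L = L0"
      using L by (intro extensionalityI[of _ "tangent_space X x"]) (simp_all add: L0_def)
  qed (rule lin)
  then show "tangent_linear X x Y (f x) (tangent_map X Y f x)"
    and "v \<in> direct_sum X x \<Longrightarrow> tangent_map X Y f x (tangent_class X x v) = tangent_class Y (f x) (?h v)"
    using lin L0 by simp_all
qed

section \<open>Lifts of centered plots and the inverse of the tangent map\<close>

text \<open>The open graph is included because local uniqueness rests on it, so that an arbitrarily
  chosen lift can still be compared with other plots of \<open>E\<close>.\<close>

definition centered_lift :: "'a diffspace \<Rightarrow> ('a \<Rightarrow> 'b) \<Rightarrow> 'a \<Rightarrow> 'b param \<Rightarrow> 'a param \<Rightarrow> bool" where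
  "centered_lift E \<pi> e = (\<lambda>(n, U, P) (k, T, L). k = n \<and> (k, T, L) \<in> centered_plots E e \<and> T \<subseteq> U \<and>
     (\<forall>r\<in>T. \<pi> (L r) = P r) \<and>
     D_open (pullback (domain_diff n U) P E \<pi>) {(r, x). r \<in> T \<and> x = L r})"

lemma centered_lift_exists:
  assumes E: "diffeological_space E" and X: "diffeological_space X" and et: "diffeological_etale_map E X \<pi>"
    and e: "e \<in> points E" and p: "p \<in> centered_plots X (\<pi> e)"
  shows "\<exists>q. centered_lift E \<pi> e p q"
proof -
  obtain n U P where pe: "p = (n, U, P)"
    by (cases p)
  then have P: "(n, U, P) \<in> plots X" "(\<lambda>_. 0) \<in> U" "P (\<lambda>_. 0) = \<pi> e"
    using p by (auto simp: centered_plots_def)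
  obtain T L where "(\<lambda>_. 0) \<in> T" "T \<subseteq> U" "(n, T, L) \<in> plots E" "\<And>r. r \<in> T \<Longrightarrow> \<pi> (L r) = P r"
    "L (\<lambda>_. 0) = e" "D_open (pullback (domain_diff n U) P E \<pi>) {(r, x). r \<in> T \<and> x = L r}"
    by (rule diffeological_etale_lift[OF E X et P(1,2) e P(3)]) blast
  then have "centered_lift E \<pi> e p (n, T, L)"
    by (simp add: centered_lift_def pe centered_plots_def)
  then show ?thesis
    by blast
qed

text \<open>Both \<open>L'\<close> and \<open>L \<circ> F\<close> lift \<open>P'\<close> near 0 and
  take the value \<open>e\<close> there, so they agree on a neighbourhood. The open graph is
  demanded of \<open>L\<close> alone: \<open>L'\<close> may be any plot of \<open>E\<close> over
  \<open>P'\<close>, which also covers the comparison of a plot of \<open>E\<close> with the chosen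
  lift of its projection.\<close>

lemma centered_lift_morphism:
  assumes E: "diffeological_space E"
    and q: "centered_lift E \<pi> e (n, U, P) (n, T, L)"
    and q': "(m, T', L') \<in> centered_plots E e" "\<And>r. r \<in> T' \<Longrightarrow> \<pi> (L' r) = P' r"
    and F: "plot_morphism (m, U', P') (n, U, P) W F"
  shows "\<exists>W'. plot_morphism (m, T', L') (n, T, L) W' F"
proof -
  have L: "(n, T, L) \<in> centered_plots E e"
    and graph: "D_open (pullback (domain_diff n U) P E \<pi>) {(r, x). r \<in> T \<and> x = L r}"
    using q by (auto simp: centered_lift_def)
  have L': "(m, T', L') \<in> plots E" "(\<lambda>_. 0) \<in> T'" "L' (\<lambda>_. 0) = e"
    using q'(1) by (auto simp: centered_plots_def)
  have W: "openin (Euclidean_space m) W" "(\<lambda>_. 0) \<in> W" "smooth_map m W n U F" "F (\<lambda>_. 0) = (\<lambda>_. 0)"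
    "\<forall>r\<in>W. P' r = P (F r)"
    using F by simp_all
  let ?V = "T' \<inter> W"
  have V: "openin (Euclidean_space m) ?V"
    using plotD(1)[OF E L'(1)] W(1) by blast
  have plot: "(m, ?V, restrict L' ?V) \<in> plots E"
    by (rule plot_subset[OF E L'(1) V]) simp
  have FV: "smooth_map m ?V n U F"
    by (rule smooth_map_subset[OF W(3)]) (use smooth_map_mem[OF W(3)] in auto)
  let ?W = "{v \<in> ?V. F v \<in> T \<and> restrict L' ?V v = L (F v)}"
  have "openin (Euclidean_space m) ?W"
    by (rule lift_unique[OF E graph plot FV]) (use q'(2) W(5) in simp)
  moreover have "(\<lambda>_. 0) \<in> ?W"
    using L' W(2,4) L by (simp add: centered_plots_def)
  moreover have "smooth_map m ?W n T F"
    by (rule smooth_map_subset[OF FV]) auto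
  ultimately have "plot_morphism (m, T', L') (n, T, L) ?W F"
    using W(4) by auto
  then show ?thesis
    by blast
qed

lemma ident_plot_morphism:
  assumes "openin (Euclidean_space n) T" "(\<lambda>_. 0) \<in> T" "T \<subseteq> U" "\<And>r. r \<in> T \<Longrightarrow> Q r = P r"
  shows "plot_morphism (n, T, Q) (n, U, P) T (\<lambda>r. r)"
  using assms by (simp add: smooth_map_inclusion)

lemma reindex_relation:
  assumes "\<And>p i c. p \<in> centered_plots X x \<Longrightarrow> i < fst p \<Longrightarrow>
      Poly_Mapping.single (p, i) c - Poly_Mapping.single (g p, i) c \<in> colimit_relations X x"
    and "v \<in> direct_sum X x"
  shows "v - reindex (map_prod g id) v \<in> colimit_relations X x"
proof (rule linear_image_direct_sum[OF _ subspace_colimit_relations assms(2)])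
  show "linear (\<lambda>v. v - reindex (map_prod g id) v)"
    by (intro linear_compose_sub linear_reindex linear_ident)
qed (simp add: assms(1))

lemma reindex_compose:
  "reindex (map_prod g id) (reindex (map_prod h id) v) = reindex (map_prod (g \<circ> h) id) v"
proof -
  let ?f = "\<lambda>v. reindex (map_prod g id) (reindex (map_prod h id) v) - reindex (map_prod (g \<circ> h) id) v"
  have "?f v \<in> {0}"
  proof (rule linear_image_in_subspace[where f = ?f])
    show "linear ?f"
      using linear_compose[OF linear_reindex linear_reindex]
      by (intro linear_compose_sub linear_reindex) (simp add: comp_def)
  qed (auto simp: subspace_def map_prod_def split: prod.split)
  then show ?thesis
    by simp
qed

text \<open>Choosing a local lift of every centered plot of the base gives an inverse of the tangent map.
  It respects the relations because lifts are locally unique, so that a morphism between centered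
  plots of the base is also one between their lifts.\<close>

lemma diffeological_etale_tangent_isomorphism:
  assumes E: "diffeological_space E" and X: "diffeological_space X" and et: "diffeological_etale_map E X \<pi>"
    and e: "e \<in> points E"
  shows "tangent_isomorphism E e X (\<pi> e) (tangent_map E X \<pi> e)"
proof -
  have sm: "smooth E X \<pi>"
    using et by (simp add: diffeological_etale_map_def)
  define lift where "lift p = (SOME q. centered_lift E \<pi> e p q)" for p
  have lift: "centered_lift E \<pi> e p (lift p)" if "p \<in> centered_plots X (\<pi> e)" for p
    unfolding lift_def by (rule someI_ex[OF centered_lift_exists[OF E X et e that]])
  let ?up = "reindex (map_prod lift id)"
  let ?down = "reindex (map_prod (push_plot \<pi>) id)"
  have lift_cen: "lift p \<in> centered_plots E e \<and> fst (lift p) = fst p" if "p \<in> centered_plots X (\<pi> e)" for p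
    using lift[OF that] by (auto simp: centered_lift_def split: prod.splits)
  have down_cen: "push_plot \<pi> q \<in> centered_plots X (\<pi> e)" if "q \<in> centered_plots E e" for q
    by (rule push_plot_centered[OF sm that])
  have up_mor: "\<exists>W'. plot_morphism (lift q) (lift p) W' F"
    if q: "q \<in> centered_plots X (\<pi> e)" and p: "p \<in> centered_plots X (\<pi> e)" and F: "plot_morphism q p W F"
    for q p W F
  proof -
    obtain m V Q where qe: "q = (m, V, Q)"
      by (cases q)
    obtain n U P where pe: "p = (n, U, P)"
      by (cases p)
    obtain T L where lp: "lift p = (n, T, L)"
      using lift[OF p] by (cases "lift p") (auto simp: centered_lift_def pe)
    obtain T' L' where lq: "lift q = (m, T', L')"
      using lift[OF q] by (cases "lift q") (auto simp: centered_lift_def qe)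
    show ?thesis
      unfolding lp lq
    proof (rule centered_lift_morphism[OF E])
      show "centered_lift E \<pi> e (n, U, P) (n, T, L)"
        using lift[OF p] unfolding lp by (simp only: pe)
      show "(m, T', L') \<in> centered_plots E e"
        using lift_cen[OF q] unfolding lq by blast
      show "\<pi> (L' r) = Q r" if "r \<in> T'" for r
        using lift[OF q] that unfolding lq by (simp add: qe centered_lift_def)
      show "plot_morphism (m, V, Q) (n, U, P) W F"
        using F by (simp only: qe pe)
    qed
  qed
  have up_rel: "?up w \<in> colimit_relations E e" if "w \<in> colimit_relations X (\<pi> e)" for w
    by (rule reindex_colimit_relations[OF lift_cen up_mor that])
  \<comment> \<open>A plot of \<open>E\<close> is itself a lift of its projection through
    \<open>e\<close>. It thus agrees near 0 with the chosen lift, and the identity germ relates the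
    two.\<close>
  have up_down: "v - ?up (?down v) \<in> colimit_relations E e" if "v \<in> direct_sum E e" for v
    unfolding reindex_compose
  proof (rule reindex_relation[OF _ that])
    fix p i c assume p: "p \<in> centered_plots E e" and i: "i < fst p"
    obtain n U P where pe: "p = (n, U, P)"
      by (cases p)
    have P: "(n, U, P) \<in> plots E" "(\<lambda>_. 0) \<in> U"
      using p by (auto simp: pe centered_plots_def)
    note pp = down_cen[OF p]
    obtain T L where lp: "lift (push_plot \<pi> p) = (n, T, L)"
      using lift[OF pp] by (cases "lift (push_plot \<pi> p)") (auto simp: centered_lift_def pe push_plot_simp)
    have "\<exists>W. plot_morphism (n, U, P) (n, T, L) W (\<lambda>r. r)"
    proof (rule centered_lift_morphism[OF E])
      show "centered_lift E \<pi> e (n, U, restrict (\<pi> \<circ> P) U) (n, T, L)"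
        using lift[OF pp] unfolding lp by (simp only: pe push_plot_simp)
      show "(n, U, P) \<in> centered_plots E e"
        using p by (simp add: pe)
      show "plot_morphism (n, U, restrict (\<pi> \<circ> P) U) (n, U, restrict (\<pi> \<circ> P) U) U (\<lambda>r. r)"
        using plotD(1)[OF E P(1)] P(2) by (intro ident_plot_morphism) simp_all
    qed simp
    then obtain W where W: "plot_morphism p ((lift \<circ> push_plot \<pi>) p) W (\<lambda>r. r)"
      unfolding pe[symmetric] lp[symmetric] by auto
    show "Poly_Mapping.single (p, i) c - Poly_Mapping.single ((lift \<circ> push_plot \<pi>) p, i) c
        \<in> colimit_relations E e"
      by (rule ident_morphism_relation[OF p _ W]) (use lift_cen[OF pp] i in simp_all)
  qed
  \<comment> \<open>Projecting the chosen lift returns \<open>P\<close> on the smaller domain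
    \<open>T\<close>. The identity is a morphism from this restriction to \<open>P\<close>, so the
    relation appears with the opposite sign.\<close>
  have down_up: "w - ?down (?up w) \<in> colimit_relations X (\<pi> e)" if "w \<in> direct_sum X (\<pi> e)" for w
    unfolding reindex_compose
  proof (rule reindex_relation[OF _ that])
    fix p i c assume p: "p \<in> centered_plots X (\<pi> e)" and i: "i < fst p"
    let ?q = "(push_plot \<pi> \<circ> lift) p"
    obtain n U P where pe: "p = (n, U, P)"
      by (cases p)
    obtain T L where lp: "lift p = (n, T, L)"
      using lift[OF p] by (cases "lift p") (auto simp: centered_lift_def pe)
    have L: "(n, T, L) \<in> plots E" "(\<lambda>_. 0) \<in> T" "T \<subseteq> U" "\<And>r. r \<in> T \<Longrightarrow> \<pi> (L r) = P r"
      using lift[OF p] unfolding lp by (auto simp: pe centered_lift_def centered_plots_def)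
    have "plot_morphism (push_plot \<pi> (n, T, L)) (n, U, P) T (\<lambda>r. r)"
      unfolding push_plot_simp using plotD(1)[OF E L(1)] L(2-4) by (intro ident_plot_morphism) simp_all
    then have "plot_morphism ?q p T (\<lambda>r. r)"
      by (simp only: comp_apply lp) (simp only: pe)
    moreover have "?q \<in> centered_plots X (\<pi> e)"
      using down_cen lift_cen[OF p] by simp
    ultimately have "Poly_Mapping.single (?q, i) c - Poly_Mapping.single (p, i) c \<in> colimit_relations X (\<pi> e)"
      using lift_cen[OF p] i p by (intro ident_morphism_relation) simp_all
    then have "- (Poly_Mapping.single (?q, i) c - Poly_Mapping.single (p, i) c) \<in> colimit_relations X (\<pi> e)"
      by (rule subspace_neg[OF subspace_colimit_relations])
    then show "Poly_Mapping.single (p, i) c - Poly_Mapping.single (?q, i) c \<in> colimit_relations X (\<pi> e)"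
      by simp
  qed
  note tm = tangent_map_class[OF sm]
  have "inj_on (tangent_map E X \<pi> e) (tangent_space E e)"
  proof (rule inj_onI)
    fix A B assume "A \<in> tangent_space E e" "B \<in> tangent_space E e"
      and eq: "tangent_map E X \<pi> e A = tangent_map E X \<pi> e B"
    then obtain v w where v: "v \<in> direct_sum E e" "A = tangent_class E e v"
      and w: "w \<in> direct_sum E e" "B = tangent_class E e w"
      by (metis tangent_spaceE)
    have "?down v - ?down w \<in> colimit_relations X (\<pi> e)"
      using eq v w by (simp add: tm(2) tangent_class_eq_iff)
    \<comment> \<open>\<open>?up\<close> preserves relations, and \<open>?up (?down (v - w))\<close>
      differs from \<open>v - w\<close> by a relation.\<close>
    then have "?up (?down (v - w)) \<in> colimit_relations E e"
      by (intro up_rel) (simp add: linear_diff[OF linear_reindex])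
    moreover have "v - w - ?up (?down (v - w)) \<in> colimit_relations E e"
      using v w by (intro up_down subspace_diff[OF subspace_direct_sum])
    ultimately have "v - w \<in> colimit_relations E e"
      using subspace_add[OF subspace_colimit_relations] by fastforce
    then show "A = B"
      by (simp add: v w tangent_class_eq_iff)
  qed
  moreover have "tangent_map E X \<pi> e ` tangent_space E e = tangent_space X (\<pi> e)"
  proof (intro equalityI subsetI)
    fix B assume "B \<in> tangent_map E X \<pi> e ` tangent_space E e"
    then show "B \<in> tangent_space X (\<pi> e)"
      using tm(1)[of e] by (auto simp: tangent_linear_def)
  next
    fix B assume "B \<in> tangent_space X (\<pi> e)"
    then obtain w where w: "w \<in> direct_sum X (\<pi> e)" "B = tangent_class X (\<pi> e) w"
      by (rule tangent_spaceE)
    have up: "?up w \<in> direct_sum E e"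
      by (rule reindex_direct_sum[OF lift_cen w(1)])
    have "B = tangent_map E X \<pi> e (tangent_class E e (?up w))"
      using down_up[OF w(1)] by (simp add: w(2) tm(2)[OF up] tangent_class_eq_iff)
    then show "B \<in> tangent_map E X \<pi> e ` tangent_space E e"
      using tangent_class_in_space[OF up] by blast
  qed
  ultimately show ?thesis
    using tm(1) by (simp add: tangent_isomorphism_def bij_betw_def)
qed


theorem corollary5p6:
  fixes E :: "'e diffspace" and X :: "'x diffspace"
  assumes "diffeological_space E" and "diffeological_space X"
  shows
    "(\<forall>\<pi>. diffeological_etale_map E X \<pi> \<longrightarrow>
        (\<forall>e\<in>points E. tangent_isomorphism E e X (\<pi> e) (tangent_map E X \<pi> e))) \<and>
     (\<forall>(M :: 'm set) \<A>. smooth_atlas M \<A> \<longrightarrow>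
        (\<forall>\<pi>\<in>points E \<rightarrow> M.
           etale_map E (manifold_diff M \<A>) \<pi> \<longleftrightarrow>
           diffeological_etale_map E (manifold_diff M \<A>) \<pi>)) \<and>
     (\<forall>\<pi>. diffeological_etale_map E X \<pi> \<longrightarrow>
        (\<forall>x\<in>points X. discrete_diff (subspace_diff E {e \<in> points E. \<pi> e = x}))) \<and>
     (\<forall>\<pi>. diffeological_etale_map E X \<pi> \<longrightarrow>
        open_map (D_topology E) (D_topology X) \<pi>) \<and>
     (\<forall>\<pi>. diffeological_etale_map E X \<pi> \<and> inj_on \<pi> (points E) \<longrightarrow>
        diffeological_embedding E X \<pi>)"
proof (intro conjI allI impI ballI)
  note E = assms(1) and X = assms(2)
  show "tangent_isomorphism E e X (\<pi> e) (tangent_map E X \<pi> e)"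
    if "diffeological_etale_map E X \<pi>" "e \<in> points E" for \<pi> e
    by (rule diffeological_etale_tangent_isomorphism[OF E X that])
  show "etale_map E (manifold_diff M \<A>) \<pi> \<longleftrightarrow> diffeological_etale_map E (manifold_diff M \<A>) \<pi>"
    if "smooth_atlas M \<A>" for M :: "'m set" and \<A> \<pi>
    using etale_map_imp_diffeological_etale[OF E diffeological_space_manifold_diff[OF that]]
      diffeological_etale_manifold_imp_etale[OF E that] by blast
  show "discrete_diff (subspace_diff E {e \<in> points E. \<pi> e = x})"
    if "diffeological_etale_map E X \<pi>" for \<pi> x
    by (rule diffeological_etale_discrete_stalk[OF E X that])
  show "open_map (D_topology E) (D_topology X) \<pi>" if "diffeological_etale_map E X \<pi>" for \<pi>
    by (rule diffeological_etale_imp_open_map[OF E X that])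
  show "diffeological_embedding E X \<pi>"
    if "diffeological_etale_map E X \<pi> \<and> inj_on \<pi> (points E)" for \<pi>
    using that by (intro injective_diffeological_etale_imp_embedding[OF E X]) blast+
qed

end
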